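(* Let $m,n$ be positive integers and let $\rho$ be the sum of $m$ standard representations of the Lie algebra $\mathfrak{b}(n)$ of upper triangular $n\times n$ matrices (over $\mathbb{C}$). 1. Assume $m\le n$. Then the Jordan--Kronecker invariants of $\rho$ are: - $\frac{(n-m)(n-m+1)}{2}$ horizontal indices, namely the union over $1\le j\le n-m$ of the following $j$ horizontal indices: writing $m=q_j\cdot j+r_j$ with integers $0\le r_j<j$, take $q_j+1$ with multiplicity $j-r_j$ and $q_j+2$ with multiplicity $r_j$ (there are no horizontal indices if $m=n$); - $m$ Jordan $1\times1$ blocks with distinct eigenvalues; - $\frac{m(m-1)}{2}$ vertical indices, namely the union over $1\le j\le m-1$ of the following $j$ vertical indices: writing $m=q_j\cdot j+r_j$ with integers $0\le r_j<j$, take $q_j$ with multiplicity $j-r_j$ and $q_j+1$ with multiplicity $r_j$. 2. Assume $m>n$. Then the Jordan--Kronecker invariants of $\rho$ are $nm-\frac{n(n+1)}{2}$ vertical indices, namely the union over $1\le j\le n$ of the following $m-j$ vertical indices: writing $m=q_j(m-j)+r_j$ with integers $0\le r_j<m-j$, take $q_j$ with multiplicity $m-j-r_j$ and $q_j+1$ with multiplicity $r_j$. In each case there are no other blocks.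
   Context: Everything is over $\mathbb{C}$ and finite-dimensional. Pencils. For linear maps $A,B:U\to V$ there are bases of $U$ and $V$ (Kronecker's theorem) in which all matrices $A+\lambda B$ are simultaneously block-diagonal, each pair of diagonal blocks $(A_i,B_i)$ being one of: (i) a $k\times k$ Jordan block with eigenvalue $\lambda_0\in\mathbb{C}$: $A_i=J_k(\lambda_0)$ (the upper triangular Jordan block), $B_i=I_k$; (ii) a $k\times k$ Jordan block with eigenvalue $\infty$: $A_i=I_k$, $B_i=J_k(0)$; (iii) a horizontal Kronecker block of size $(h-1)\times h$, $h\ge 1$: $A_i=(0\,|\,I_{h-1})$, $B_i=(I_{h-1}\,|\,0)$; (iv) a vertical Kronecker block of size $v\times(v-1)$, $v\ge1$: the transposes of the matrices in (iii) with $h=v$. A $0\times 1$ horizontal block ($h=1$) is a zero column and a $1\times 0$ vertical block ($v=1$) is a zero row. The blocks are unique up to permutation. The numbers $h$ (widths of horizontal blocks) are the horizontal indices, the numbers $v$ (heights of vertical blocks) are the vertical indices. Representations. For a representation $\rho:\mathfrak{g}\to\mathfrak{gl}(V)$ and $x\in V$ put $R_x:\mathfrak{g}\to V$, $R_x(\xi)=\rho(\xi)x$. The algebraic type of the pencil $R_a+\lambda R_b=R_{a+\lambda b}$ is the collection: number of distinct eigenvalues of Jordan blocks, number and sizes of the Jordan blocks for each eigenvalue, horizontal and vertical indices (with multiplicity). The Jordan--Kronecker (JK) invariants of $\rho$ are the algebraic type of $R_{a+\lambda b}$ for a generic pair $(a,b)\in V\times V$ (i.e. for all pairs in some non-empty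 Zariski open subset). The sum of $m$ standard representations of a matrix Lie algebra $\mathfrak{g}\subset\mathfrak{gl}(n)$ is the representation on $n\times m$ matrices given by $\rho(Y)X=YX$, $Y\in\mathfrak{g}$, $X\in\mathrm{Mat}_{n\times m}$. Unions of indices are unions of multisets. *)

theory Defs
  imports
    "HOL-Library.Multiset"
    "Jordan_Normal_Form.VS_Connect"
    "Jordan_Normal_Form.Jordan_Normal_Form"
begin

section \<open>Kronecker canonical form of a pencil\<close>

text \<open>
  In \<open>Jordan k e\<close> the eigenvalue \<open>e\<close> is a point of the projective line: \<open>None\<close> is infinity.
  A horizontal block is given by its width and a vertical block by its height.
\<close>

datatype pencil_block =
    Jordan nat "complex option"
  | Horizontal nat
  | Vertical nat

fun block_size :: "pencil_block \<Rightarrow> nat" where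
  "block_size (Jordan k e) = k"
| "block_size (Horizontal h) = h"
| "block_size (Vertical v) = v"

definition horizontal_A :: "nat \<Rightarrow> complex mat" where
  "horizontal_A h = mat (h - 1) h (\<lambda>(i, j). if j = i + 1 then 1 else 0)"

definition horizontal_B :: "nat \<Rightarrow> complex mat" where
  "horizontal_B h = mat (h - 1) h (\<lambda>(i, j). if j = i then 1 else 0)"

fun block_A :: "pencil_block \<Rightarrow> complex mat" where
  "block_A (Jordan k (Some e)) = jordan_block k e"
| "block_A (Jordan k None) = 1\<^sub>m k"
| "block_A (Horizontal h) = horizontal_A h"
| "block_A (Vertical v) = (horizontal_A v)\<^sup>T"

fun block_B :: "pencil_block \<Rightarrow> complex mat" where
  "block_B (Jordan k (Some e)) = 1\<^sub>m k"
| "block_B (Jordan k None) = jordan_block k 0"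
| "block_B (Horizontal h) = horizontal_B h"
| "block_B (Vertical v) = (horizontal_B v)\<^sup>T"

definition is_matrix_of ::
  "complex mat \<Rightarrow> (complex, 'v) module \<Rightarrow> 'u list \<Rightarrow> 'v list \<Rightarrow> ('u \<Rightarrow> 'v) \<Rightarrow> bool" where
  "is_matrix_of M V us vs f \<longleftrightarrow>
     M \<in> carrier_mat (length vs) (length us) \<and>
     (\<forall>j < length us. f (us ! j) = (\<Oplus>\<^bsub>V\<^esub> i \<in> {..<length vs}. M $$ (i, j) \<odot>\<^bsub>V\<^esub> vs ! i))"

definition ordered_basis :: "(complex, 'v) module \<Rightarrow> 'v list \<Rightarrow> bool" where
  "ordered_basis V vs \<longleftrightarrow> distinct vs \<and> vectorspace.basis class_ring V (set vs)"

definition has_kronecker_form ::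
  "(complex, 'u) module \<Rightarrow> (complex, 'v) module \<Rightarrow> ('u \<Rightarrow> 'v) \<Rightarrow> ('u \<Rightarrow> 'v) \<Rightarrow>
     pencil_block list \<Rightarrow> bool" where
  "has_kronecker_form U V A B bs \<longleftrightarrow>
     (\<forall>b \<in> set bs. 1 \<le> block_size b) \<and>
     (\<exists>us vs. ordered_basis U us \<and> ordered_basis V vs \<and>
        is_matrix_of (diag_block_mat (map block_A bs)) V us vs A \<and>
        is_matrix_of (diag_block_mat (map block_B bs)) V us vs B)"

text \<open>
  The algebraic type forgets the values of the eigenvalues but keeps which Jordan blocks
  share one: \<open>jordan_sizes\<close> has one element per distinct eigenvalue, namely the
  multiset of the sizes of the Jordan blocks with that eigenvalue.
\<close>

record algebraic_type =
  jordan_sizes :: "nat multiset multiset"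
  horizontal_indices :: "nat multiset"
  vertical_indices :: "nat multiset"

definition sizes_at :: "pencil_block list \<Rightarrow> complex option \<Rightarrow> nat multiset" where
  "sizes_at bs e = mset [k. Jordan k e' \<leftarrow> bs, e' = e]"

definition type_of_blocks :: "pencil_block list \<Rightarrow> algebraic_type" where
  "type_of_blocks bs =
     \<lparr> jordan_sizes = image_mset (sizes_at bs) (mset_set {e. \<exists>k. Jordan k e \<in> set bs}),
       horizontal_indices = mset [h. Horizontal h \<leftarrow> bs],
       vertical_indices = mset [v. Vertical v \<leftarrow> bs] \<rparr>"

text \<open>
  Every pencil has a type and, the blocks being unique up to permutation, exactly one.
\<close>

definition has_algebraic_type ::
  "(complex, 'u) module \<Rightarrow> (complex, 'v) module \<Rightarrow> ('u \<Rightarrow> 'v) \<Rightarrow> ('u \<Rightarrow> 'v) \<Rightarrow>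
     algebraic_type \<Rightarrow> bool" where
  "has_algebraic_type U V A B T \<longleftrightarrow>
     (\<exists>bs. has_kronecker_form U V A B bs \<and> type_of_blocks bs = T)"


section \<open>Zariski topology of a finite-dimensional space\<close>

text \<open>
  The polynomial functions are generated by the constants and the linear functionals. They
  are total functions whose values outside the carrier are irrelevant.
\<close>

inductive_set polynomial_functions :: "(complex, 'v) module \<Rightarrow> ('v \<Rightarrow> complex) set"
  for W :: "(complex, 'v) module" where
  const: "(\<lambda>_. c) \<in> polynomial_functions W"
| linear: "(\<And>x y. x \<in> carrier W \<Longrightarrow> y \<in> carrier W \<Longrightarrow> f (x \<oplus>\<^bsub>W\<^esub> y) = f x + f y) \<Longrightarrow>
     (\<And>c x. x \<in> carrier W \<Longrightarrow> f (c \<odot>\<^bsub>W\<^esub> x) = c * f x) \<Longrightarrow>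
     f \<in> polynomial_functions W"
| add: "f \<in> polynomial_functions W \<Longrightarrow> g \<in> polynomial_functions W \<Longrightarrow>
     (\<lambda>x. f x + g x) \<in> polynomial_functions W"
| mult: "f \<in> polynomial_functions W \<Longrightarrow> g \<in> polynomial_functions W \<Longrightarrow>
     (\<lambda>x. f x * g x) \<in> polynomial_functions W"

definition zariski_open :: "(complex, 'v) module \<Rightarrow> 'v set \<Rightarrow> bool" where
  "zariski_open W S \<longleftrightarrow>
     (\<exists>F \<subseteq> polynomial_functions W. S = {x \<in> carrier W. \<exists>f \<in> F. f x \<noteq> 0})"


section \<open>Jordan--Kronecker invariants of a representation\<close>

text \<open>
  Only the underlying vector spaces \<open>\<gg>\<close> and \<open>V\<close> and the action
  \<open>\<rho> \<xi> x\<close> enter, through the maps \<open>R\<^sub>x = (\<lambda>\<xi>. \<rho> \<xi> x)\<close>.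
\<close>

definition has_JK_invariants ::
  "(complex, 'g) module \<Rightarrow> (complex, 'v) module \<Rightarrow> ('g \<Rightarrow> 'v \<Rightarrow> 'v) \<Rightarrow>
     algebraic_type \<Rightarrow> bool" where
  "has_JK_invariants \<gg> V \<rho> T \<longleftrightarrow>
     (\<exists>S. zariski_open (direct_sum V V) S \<and> S \<noteq> {} \<and>
        (\<forall>(a, b) \<in> S. has_algebraic_type \<gg> V (\<lambda>\<xi>. \<rho> \<xi> a) (\<lambda>\<xi>. \<rho> \<xi> b) T))"

abbreviation Mat :: "nat \<Rightarrow> nat \<Rightarrow> (complex, complex mat) module" where
  "Mat n m \<equiv> module_mat TYPE(complex) n m"

definition upper_triangular_algebra :: "nat \<Rightarrow> (complex, complex mat) module"  ("\<bb>") where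
  "\<bb> n = (Mat n n)\<lparr>carrier := {Y \<in> carrier_mat n n. upper_triangular Y}\<rparr>"

text \<open>
  The sum of \<open>m\<close> standard representations is this action on \<open>n \<times> m\<close> matrices; the
  number \<open>m\<close> is carried by the space \<open>Mat n m\<close>.
\<close>

definition standard_sum :: "complex mat \<Rightarrow> complex mat \<Rightarrow> complex mat" where
  "standard_sum Y X = Y * X"


lemma vectorspace_Mat: "vectorspace class_ring (Mat n m)"
proof -
  interpret abelian_group "Mat n m" by (rule abelian_group_mat)
  show ?thesis
    by unfold_locales
      (auto simp: module_mat_simps class_ring_simps add_smult_distrib_left_mat
         add_smult_distrib_right_mat mult_smult_assoc_mat intro!: eq_matI)
qed

lemma subspace_upper_triangular:
  "VectorSpace.subspace class_ring {Y \<in> carrier_mat n n. upper_triangular Y} (Mat n n)"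
  unfolding VectorSpace.subspace_def submodule_def
  using vectorspace_Mat[of n n]
  by (auto simp: vectorspace_def module_mat_simps upper_triangular_def)

lemma vectorspace_upper_triangular: "vectorspace class_ring (\<bb> n)"
  unfolding upper_triangular_algebra_def
  using vectorspace.subspace_is_vs[OF vectorspace_Mat subspace_upper_triangular] by simp

lemma upper_triangular_algebra_bracket_closed:
  assumes "Y \<in> carrier (\<bb> n)" "Z \<in> carrier (\<bb> n)"
  shows "Y * Z - Z * Y \<in> carrier (\<bb> n)"
proof -
  have *: "(P * Q) $$ (i, j) = 0"
    if "P \<in> carrier (\<bb> n)" "Q \<in> carrier (\<bb> n)" "i < n" "j < i" for P Q i j
  proof -
    have "P $$ (i, k) * Q $$ (k, j) = 0" if "k < n" for k
      using that \<open>P \<in> _\<close> \<open>Q \<in> _\<close> \<open>i < n\<close> \<open>j < i\<close>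
      by (cases "k < i") (auto simp: upper_triangular_algebra_def upper_triangular_def)
    then show ?thesis
      using that by (auto simp: upper_triangular_algebra_def scalar_prod_def intro!: sum.neutral)
  qed
  show ?thesis
    using assms *[of Y Z] *[of Z Y]
    by (auto simp: upper_triangular_algebra_def intro!: upper_triangularI)
qed

lemma standard_sum_bracket:
  assumes "Y \<in> carrier_mat n n" "Z \<in> carrier_mat n n" "X \<in> carrier_mat n m"
  shows "standard_sum (Y * Z - Z * Y) X =
    standard_sum Y (standard_sum Z X) - standard_sum Z (standard_sum Y X)"
  using assms unfolding standard_sum_def
  by (subst minus_mult_distrib_mat[of _ n n]) (auto simp: assoc_mult_mat[of _ n n])


text \<open>
  The \<open>j\<close> numbers obtained by splitting \<open>m = q * j + r\<close>, \<open>0 \<le> r < j\<close>,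
  into \<open>j\<close> parts \<open>q\<close> and \<open>q + 1\<close> that are as equal as possible, each then raised by \<open>c\<close>.
\<close>

definition balanced_indices :: "nat \<Rightarrow> nat \<Rightarrow> nat \<Rightarrow> nat multiset" where
  "balanced_indices c m j =
     (let q = m div j; r = m mod j
      in replicate_mset (j - r) (q + c) + replicate_mset r (q + c + 1))"

end

theory Submission
  imports
    Defs
    "HOL-Computational_Algebra.Field_as_Ring"
    "Jordan_Normal_Form.Jordan_Normal_Form_Existence"
    "Subresultants.Subresultant_Gcd"
begin

text \<open>
  The last \<open>l\<close> entries of row \<open>n - l\<close> of \<open>Y \<in> \<bb> n\<close> act on the last \<open>l\<close> rows of \<open>X\<close>
  only, so the pencil is the direct sum over \<open>1 \<le> l \<le> n\<close> of the \<open>l \<times> m\<close> pencils formed by the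
  last \<open>l\<close> rows of \<open>a\<close> and \<open>b\<close>, each of which is generic.

  A generic square pencil is diagonalizable with distinct eigenvalues. A generic
  \<open>p \<times> (p + d)\<close> pencil with \<open>d > 0\<close> is equivalent to \<open>A = (0 | I)\<close>, \<open>B = (I | 0)\<close>: iterating
  \<open>A\<^sup>-\<^sup>1 B\<close> on the kernel of \<open>A\<close> gives bases in which \<open>A = (0 | I)\<close> and \<open>B = (I | Z)\<close>, and a
  unitriangular change of basis that respects the shift by \<open>d\<close> removes \<open>Z\<close>. The residue
  classes modulo \<open>d\<close> then split this pencil into \<open>d\<close> Kronecker blocks of almost equal size. A
  tall pencil is treated by transposition. The genericity conditions are polynomial, and a product
  of polynomial functions that do not vanish identically does not vanish identically.
\<close>

section \<open>Polynomial functions\<close>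

text \<open>The invariants are defined through a Zariski open set of pairs, so every choice made
  while reducing a pencil has to be governed by polynomial functions of \<open>(a, b)\<close>. This
  is why determinants, adjugates and a resultant stand where inverses and eigenvectors would be
  natural: for each \<open>l\<close> a single polynomial \<open>row_genericity\<close> certifies the
  whole reduction. The pencils for different \<open>l\<close> share rows of \<open>a\<close> and
  \<open>b\<close>, so they cannot be put in general position independently. It is enough that each
  polynomial has a witness of its own, since then their product is nonzero somewhere.

  An algebra element multiplies \<open>X\<close> from the left, so the \<open>l \<times> m\<close>
  matrices act on row vectors: the domain has dimension \<open>l\<close> and the codomain dimension
  \<open>m\<close>. Wide matrices (\<open>l < m\<close>) therefore give vertical blocks and tall
  ones horizontal blocks. Jordan blocks arise for \<open>l = m\<close> only, so eigenvalues coming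
  from different \<open>l\<close> never have to be compared.\<close>

lemma polynomial_functions_sum:
  assumes "\<And>i. i \<in> I \<Longrightarrow> f i \<in> polynomial_functions W"
  shows "(\<lambda>x. \<Sum>i\<in>I. f i x) \<in> polynomial_functions W"
  using assms
proof (induction I rule: infinite_finite_induct)
  case (insert i I)
  then show ?case by (simp add: polynomial_functions.add)
qed (auto intro: polynomial_functions.const)

lemma polynomial_functions_prod:
  assumes "\<And>i. i \<in> I \<Longrightarrow> f i \<in> polynomial_functions W"
  shows "(\<lambda>x. \<Prod>i\<in>I. f i x) \<in> polynomial_functions W"
  using assms
proof (induction I rule: infinite_finite_induct)
  case (insert i I)
  then show ?case by (simp add: polynomial_functions.mult)
qed (auto intro: polynomial_functions.const)

lemma polynomial_functions_uminus:
  assumes "f \<in> polynomial_functions W"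
  shows "(\<lambda>x. - f x) \<in> polynomial_functions W"
  using polynomial_functions.mult[OF polynomial_functions.const[of "-1"] assms] by simp

lemmas polynomial_functions_intros =
  polynomial_functions.const polynomial_functions.add polynomial_functions.mult
  polynomial_functions_sum polynomial_functions_prod polynomial_functions_uminus

lemma polynomial_functions_det:
  assumes "\<And>x. M x \<in> carrier_mat k k"
    and "\<And>i j. i < k \<Longrightarrow> j < k \<Longrightarrow> (\<lambda>x. M x $$ (i, j)) \<in> polynomial_functions W"
  shows "(\<lambda>x. det (M x)) \<in> polynomial_functions W"
proof -
  have "(\<lambda>x. \<Sum>p\<in>{p. p permutes {0..<k}}. signof p * (\<Prod>i = 0..<k. M x $$ (i, p i)))
      \<in> polynomial_functions W"
    by (intro polynomial_functions_intros assms(2)) (auto dest: permutes_in_image)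
  then show ?thesis
    by (subst det_def'[OF assms(1)])
qed

lemma polynomial_functions_adj_mat:
  assumes "\<And>x. M x \<in> carrier_mat k k"
    and "\<And>i j. i < k \<Longrightarrow> j < k \<Longrightarrow> (\<lambda>x. M x $$ (i, j)) \<in> polynomial_functions W"
    and "i < k" "j < k"
  shows "(\<lambda>x. adj_mat (M x) $$ (i, j)) \<in> polynomial_functions W"
proof -
  have dims: "dim_row (M x) = k" "dim_col (M x) = k" for x
    using assms(1)[of x] by auto
  have "(\<lambda>x. det (mat_delete (M x) j i)) \<in> polynomial_functions W"
  proof (rule polynomial_functions_det[where k = "k - 1"])
    show "mat_delete (M x) j i \<in> carrier_mat (k - 1) (k - 1)" for x
      using assms(1) by (rule mat_delete_carrier)
    show "(\<lambda>x. mat_delete (M x) j i $$ (i', j')) \<in> polynomial_functions W"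
      if "i' < k - 1" "j' < k - 1" for i' j'
      using that assms(2) by (auto simp: mat_delete_def dims)
  qed
  then show ?thesis
    using assms(3,4) unfolding adj_mat_def cofactor_def dims
    by (auto intro!: polynomial_functions_intros)
qed

lemma polynomial_functions_mult_mat:
  assumes "\<And>x. M x \<in> carrier_mat k r" "\<And>x. N x \<in> carrier_mat r c"
    and "\<And>i j. i < k \<Longrightarrow> j < r \<Longrightarrow> (\<lambda>x. M x $$ (i, j)) \<in> polynomial_functions W"
    and "\<And>i j. i < r \<Longrightarrow> j < c \<Longrightarrow> (\<lambda>x. N x $$ (i, j)) \<in> polynomial_functions W"
    and "i < k" "j < c"
  shows "(\<lambda>x. (M x * N x) $$ (i, j)) \<in> polynomial_functions W"
proof -
  have dims: "dim_row (M x) = k" "dim_col (M x) = r" "dim_row (N x) = r" "dim_col (N x) = c" for x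
    using assms(1,2)[of x] by auto
  have "(M x * N x) $$ (i, j) = (\<Sum>t = 0..<r. M x $$ (i, t) * N x $$ (t, j))" for x
    using assms(5,6) by (simp add: scalar_prod_def dims)
  then show ?thesis
    using assms(3-6) by (auto intro!: polynomial_functions_intros)
qed

lemma polynomial_functions_coeff_prod:
  assumes "\<And>i r. i \<in> I \<Longrightarrow> (\<lambda>x. coeff (f i x) r) \<in> polynomial_functions W"
  shows "(\<lambda>x. coeff (\<Prod>i\<in>I. f i x) r) \<in> polynomial_functions W"
  using assms
proof (induction I arbitrary: r rule: infinite_finite_induct)
  case (insert i I)
  then show ?case
    by (simp add: coeff_mult) (intro polynomial_functions_intros insert; simp)
qed (auto intro: polynomial_functions.const)

lemma polynomial_functions_coeff_char_poly:
  assumes "\<And>x. M x \<in> carrier_mat k k"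
    and "\<And>i j. i < k \<Longrightarrow> j < k \<Longrightarrow> (\<lambda>x. M x $$ (i, j)) \<in> polynomial_functions W"
  shows "(\<lambda>x. coeff (char_poly (M x)) r) \<in> polynomial_functions W"
proof -
  have dims: "dim_row (M x) = k" "dim_col (M x) = k" for x
    using assms(1)[of x] by auto
  have entry: "(\<lambda>x. coeff (char_poly_matrix (M x) $$ (i, j)) s) \<in> polynomial_functions W"
    if "i < k" "j < k" for i j s
    using that assms(2)
    by (cases s; cases "i = j")
      (auto simp: char_poly_matrix_def dims coeff_pCons intro!: polynomial_functions_intros
        split: nat.splits)
  \<comment> \<open>On the left \<open>signof p\<close> is a constant polynomial, 1 or -1, so it
    passes through the extraction of a coefficient.\<close>
  have signof: "coeff (signof p * q) r = signof p * coeff q r"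
    for p :: "nat \<Rightarrow> nat" and q :: "complex poly"
    by (simp add: sign_def)
  have "char_poly (M x) =
      (\<Sum>p\<in>{p. p permutes {0..<k}}. signof p * (\<Prod>i = 0..<k. char_poly_matrix (M x) $$ (i, p i)))" for x
    unfolding char_poly_def by (rule det_def') (use assms(1) in auto)
  then have "coeff (char_poly (M x)) r = (\<Sum>p\<in>{p. p permutes {0..<k}}.
      signof p * coeff (\<Prod>i = 0..<k. char_poly_matrix (M x) $$ (i, p i)) r)" for x
    by (simp add: coeff_sum signof)
  then show ?thesis
    by (auto intro!: polynomial_functions_intros polynomial_functions_coeff_prod entry
        dest: permutes_in_image)
qed

section \<open>Restriction to lines and non-vanishing of products\<close>

lemma polynomial_function_on_line:
  assumes "Module.module class_ring W" "x \<in> carrier W" "z \<in> carrier W" "f \<in> polynomial_functions W"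
  shows "\<exists>p. \<forall>t. f (x \<oplus>\<^bsub>W\<^esub> t \<odot>\<^bsub>W\<^esub> z) = poly p t"
  using assms(4)
proof induction
  case (const c)
  show ?case by (rule exI[of _ "[:c:]"]) simp
next
  case (linear f)
  have "t \<odot>\<^bsub>W\<^esub> z \<in> carrier W" for t
    using Module.module.smult_closed[OF assms(1), of t z] assms(3) by simp
  then show ?case
    by (intro exI[of _ "[:f x, f z:]"]) (simp add: linear assms)
next
  case (add f g)
  then show ?case by (metis poly_add)
next
  case (mult f g)
  then show ?case by (metis poly_mult)
qed

text \<open>Join \<open>x\<close> to \<open>y\<close> by a line. Restricted to it, \<open>f\<close>
  and \<open>g\<close> become polynomials in one variable, nonzero at the parameters 0 and 1
  respectively; their product is a nonzero polynomial and has only finitely many roots among the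
  infinitely many parameters.\<close>

lemma polynomial_functions_mult_nonzero:
  assumes W: "Module.module class_ring W"
    and f: "f \<in> polynomial_functions W" "x \<in> carrier W" "f x \<noteq> 0"
    and g: "g \<in> polynomial_functions W" "y \<in> carrier W" "g y \<noteq> 0"
  shows "\<exists>z\<in>carrier W. f z * g z \<noteq> 0"
proof -
  interpret W: Module.module class_ring W by (rule W)
  let ?d = "y \<ominus>\<^bsub>W\<^esub> x"
  have d: "?d \<in> carrier W" using f(2) g(2) by simp
  obtain p where p: "\<And>t. f (x \<oplus>\<^bsub>W\<^esub> t \<odot>\<^bsub>W\<^esub> ?d) = poly p t"
    using polynomial_function_on_line[OF W f(2) d f(1)] by auto
  obtain q where q: "\<And>t. g (x \<oplus>\<^bsub>W\<^esub> t \<odot>\<^bsub>W\<^esub> ?d) = poly q t"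
    using polynomial_function_on_line[OF W f(2) d g(1)] by auto
  have "x \<oplus>\<^bsub>W\<^esub> 0 \<odot>\<^bsub>W\<^esub> ?d = x"
    using W.smult_l_null[OF d] f(2) by simp
  then have "p \<noteq> 0" using p[of 0] f(3) by auto
  moreover have "x \<oplus>\<^bsub>W\<^esub> 1 \<odot>\<^bsub>W\<^esub> ?d = y"
    using W.smult_one[OF d] f(2) g(2) W.a_lcomm[of x y "\<ominus>\<^bsub>W\<^esub> x"]
    by (simp add: a_minus_def W.r_neg)
  then have "q \<noteq> 0" using q[of 1] g(3) by auto
  ultimately have "p * q \<noteq> 0" by simp
  then have "finite {t. poly (p * q) t = 0}" by (rule poly_roots_finite)
  then obtain t where "poly (p * q) t \<noteq> 0"
    using infinite_UNIV_char_0[where 'a = complex] by (metis (mono_tags) UNIV_eq_I mem_Collect_eq)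
  then show ?thesis
    using d f(2) W.smult_closed[of t ?d]
    by (intro bexI[of _ "x \<oplus>\<^bsub>W\<^esub> t \<odot>\<^bsub>W\<^esub> ?d"]) (auto simp: p q)
qed

lemma polynomial_functions_prod_nonzero:
  assumes "Module.module class_ring W" "finite I"
    and "\<And>i. i \<in> I \<Longrightarrow> f i \<in> polynomial_functions W"
    and "\<And>i. i \<in> I \<Longrightarrow> \<exists>x\<in>carrier W. f i x \<noteq> 0"
  shows "\<exists>x\<in>carrier W. (\<Prod>i\<in>I. f i x) \<noteq> 0"
  using assms(2-)
proof (induction I)
  case empty
  then show ?case
    using abelian_group.axioms[OF Module.module.axioms(2)[OF assms(1)]]
    by (auto intro!: bexI[of _ "\<zero>\<^bsub>W\<^esub>"] abelian_monoid.zero_closed)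
next
  case (insert i I)
  then obtain x y where "x \<in> carrier W" "f i x \<noteq> 0" "y \<in> carrier W" "(\<Prod>i\<in>I. f i y) \<noteq> 0"
    by blast
  then show ?case
    using polynomial_functions_mult_nonzero[OF assms(1), of "f i" x "\<lambda>x. \<Prod>i\<in>I. f i x" y] insert
    by (auto intro: polynomial_functions_prod)
qed

section \<open>Generic rectangular pencils\<close>

lemma adj_mat_one: "adj_mat (1\<^sub>m k) = (1\<^sub>m k :: 'a :: comm_ring_1 mat)"
  using adj_mat(1,2)[of "1\<^sub>m k :: 'a mat" k]
  by (auto simp: left_mult_one_mat[of _ k k] intro!: eq_matI)

lemma sum_atLeast0_split_add:
  "(\<Sum>c = 0..<d + p. f c) = (\<Sum>c = 0..<d. f c) + (\<Sum>c = 0..<p. f (d + c))"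
  for f :: "nat \<Rightarrow> 'a :: comm_monoid_add"
  by (induction p) (simp_all add: add.assoc)

text \<open>
  For a \<open>p \<times> (p + d)\<close> pencil write \<open>A = (A' | A\<^sub>1)\<close> with \<open>A\<^sub>1\<close> square. The vectors
  \<open>u\<^sub>0, u\<^sub>1, \<dots>\<close> start with a basis of the kernel of \<open>A\<close> and continue by
  \<open>A u\<^sub>t = det A\<^sub>1 \<cdot> B u\<^sub>t\<^sub>-\<^sub>d\<close>. The adjugate replaces the inverse of \<open>A\<^sub>1\<close> in order to keep
  them polynomial in the entries of the pencil.
\<close>

definition last_square :: "nat \<Rightarrow> nat \<Rightarrow> complex mat \<Rightarrow> complex mat" where
  "last_square p d A = mat p p (\<lambda>(i, j). A $$ (i, d + j))"

function chain_vec :: "nat \<Rightarrow> nat \<Rightarrow> complex mat \<Rightarrow> complex mat \<Rightarrow> nat \<Rightarrow> complex vec" where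
  "chain_vec p d A B t =
    (if t < d then vec (d + p) (\<lambda>c.
       if c < d then if c = t then det (last_square p d A) else 0
       else - (\<Sum>s = 0..<p. adj_mat (last_square p d A) $$ (c - d, s) * A $$ (s, t)))
     else if d = 0 then 0\<^sub>v (d + p)
     else vec (d + p) (\<lambda>c. if c < d then 0
       else \<Sum>s = 0..<p. adj_mat (last_square p d A) $$ (c - d, s) *
         (\<Sum>r = 0..<d + p. B $$ (s, r) * chain_vec p d A B (t - d) $ r)))"
  by auto
termination by (relation "measure (\<lambda>(p, d, A, B, t). t)") auto

declare chain_vec.simps [simp del]

lemma last_square_carrier [simp]: "last_square p d A \<in> carrier_mat p p"
  by (simp add: last_square_def)

lemma chain_vec_index:
  assumes "c < d"
  shows "chain_vec p d A B t $ c = (if c = t then det (last_square p d A) else 0)"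
  using assms by (subst chain_vec.simps) auto

lemma last_square_adj_mat:
  assumes "i < p" "j < p"
  shows "(\<Sum>c = 0..<p. A $$ (i, d + c) * adj_mat (last_square p d A) $$ (c, j)) =
    (if i = j then det (last_square p d A) else 0)"
proof -
  let ?L = "last_square p d A"
  note adj = adj_mat[OF last_square_carrier[of p d A]]
  have "(\<Sum>c = 0..<p. A $$ (i, d + c) * adj_mat ?L $$ (c, j)) = (?L * adj_mat ?L) $$ (i, j)"
    using assms adj(1) by (auto simp: scalar_prod_def last_square_def)
  then show ?thesis
    using assms by (simp add: adj(2))
qed

text \<open>The first \<open>d\<close> coordinates of \<open>u_t\<close> are \<open>det A_1\<close>
  times a unit vector if \<open>t < d\<close> and zero otherwise, so the left part of
  \<open>A\<close> contributes a multiple of column \<open>t\<close> or nothing. The other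
  coordinates begin with the adjugate, which \<open>A_1\<close> turns into the factor
  \<open>det A_1\<close>; for \<open>t < d\<close> the two contributions cancel.\<close>

lemma chain_vec_mult:
  assumes "0 < d" "i < p"
  shows "(\<Sum>c = 0..<d + p. A $$ (i, c) * chain_vec p d A B t $ c) =
    (if t < d then 0 else det (last_square p d A) *
       (\<Sum>c = 0..<d + p. B $$ (i, c) * chain_vec p d A B (t - d) $ c))"
proof -
  let ?L = "last_square p d A"
  have adj: "(\<Sum>c = 0..<p. A $$ (i, d + c) * (\<Sum>s = 0..<p. adj_mat ?L $$ (c, s) * f s)) = det ?L * f i"
    for f :: "nat \<Rightarrow> complex"
  proof -
    have "(\<Sum>c = 0..<p. A $$ (i, d + c) * (\<Sum>s = 0..<p. adj_mat ?L $$ (c, s) * f s)) =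
      (\<Sum>s = 0..<p. (\<Sum>c = 0..<p. A $$ (i, d + c) * adj_mat ?L $$ (c, s)) * f s)"
      by (simp add: sum_distrib_left sum_distrib_right mult.assoc) (rule sum.swap)
    also have "\<dots> = (\<Sum>s = 0..<p. (if i = s then det ?L else 0) * f s)"
      by (intro sum.cong refl) (simp add: last_square_adj_mat assms)
    also have "\<dots> = det ?L * f i"
      using assms by (simp add: if_distrib[of "\<lambda>x. x * _"] cong: if_cong)
    finally show ?thesis .
  qed
  have top: "(\<Sum>c = 0..<d. A $$ (i, c) * chain_vec p d A B t $ c) =
    (if t < d then A $$ (i, t) * det ?L else 0)"
    by (auto simp: chain_vec_index if_distrib[of "\<lambda>x. _ * x"] cong: if_cong intro!: sum.neutral)
  have "(\<Sum>c = 0..<p. A $$ (i, d + c) * chain_vec p d A B t $ (d + c)) =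
    (if t < d then - (\<Sum>c = 0..<p. A $$ (i, d + c) * (\<Sum>s = 0..<p. adj_mat ?L $$ (c, s) * A $$ (s, t)))
     else (\<Sum>c = 0..<p. A $$ (i, d + c) * (\<Sum>s = 0..<p. adj_mat ?L $$ (c, s) *
         (\<Sum>r = 0..<d + p. B $$ (s, r) * chain_vec p d A B (t - d) $ r))))"
    using assms by (subst chain_vec.simps) (auto simp: sum_negf)
  then show ?thesis
    unfolding sum_atLeast0_split_add[where d = d and f = "\<lambda>c. A $$ (i, c) * _ c"] adj top by simp
qed

lemma polynomial_functions_chain_vec:
  assumes A: "\<And>i j. i < p \<Longrightarrow> j < d + p \<Longrightarrow> (\<lambda>x. A x $$ (i, j)) \<in> polynomial_functions W"
    and B: "\<And>i j. i < p \<Longrightarrow> j < d + p \<Longrightarrow> (\<lambda>x. B x $$ (i, j)) \<in> polynomial_functions W"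
    and "c < d + p"
  shows "(\<lambda>x. chain_vec p d (A x) (B x) t $ c) \<in> polynomial_functions W"
  using assms(3)
proof (induction t arbitrary: c rule: less_induct)
  case (less t)
  have L: "(\<lambda>x. last_square p d (A x) $$ (i, j)) \<in> polynomial_functions W"
    if "i < p" "j < p" for i j
    using that A by (simp add: last_square_def)
  have detL: "(\<lambda>x. det (last_square p d (A x))) \<in> polynomial_functions W"
    by (rule polynomial_functions_det[where k = p]) (auto intro: L)
  have adjL: "(\<lambda>x. adj_mat (last_square p d (A x)) $$ (i, j)) \<in> polynomial_functions W"
    if "i < p" "j < p" for i j
    by (rule polynomial_functions_adj_mat[where k = p]) (auto intro: L that)
  have "(\<lambda>x. \<Sum>s = 0..<p. adj_mat (last_square p d (A x)) $$ (c - d, s) * A x $$ (s, t))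
      \<in> polynomial_functions W" if "t < d" "\<not> c < d"
    using that less.prems by (intro polynomial_functions_intros adjL A) auto
  moreover have "(\<lambda>x. \<Sum>s = 0..<p. adj_mat (last_square p d (A x)) $$ (c - d, s) *
      (\<Sum>r = 0..<d + p. B x $$ (s, r) * chain_vec p d (A x) (B x) (t - d) $ r))
      \<in> polynomial_functions W" if "\<not> t < d" "0 < d" "\<not> c < d"
    using that less.prems by (intro polynomial_functions_intros adjL B less.IH) auto
  ultimately show ?case
    using less.prems detL
    by (subst chain_vec.simps, cases "t < d"; cases "c < d"; cases "d = 0"; cases "c = t")
      (simp_all add: polynomial_functions_intros)
qed

definition chain_mat :: "nat \<Rightarrow> nat \<Rightarrow> complex mat \<Rightarrow> complex mat \<Rightarrow> complex mat" where
  "chain_mat p d A B = mat p p (\<lambda>(i, t). \<Sum>c = 0..<d + p. B $$ (i, c) * chain_vec p d A B t $ c)"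

text \<open>The first factor makes \<open>A_1\<close> invertible; the second makes
  \<open>B u_0, ..., B u_(p-1)\<close> a basis of the target. The later \<open>B u_t\<close> are
  then combinations of these, with coefficients that are eliminated afterwards.\<close>

definition pencil_genericity :: "nat \<Rightarrow> nat \<Rightarrow> complex mat \<Rightarrow> complex mat \<Rightarrow> complex" where
  "pencil_genericity p d A B = det (last_square p d A) * det (chain_mat p d A B)"

lemma polynomial_functions_pencil_genericity:
  assumes "\<And>i j. i < p \<Longrightarrow> j < d + p \<Longrightarrow> (\<lambda>x. A x $$ (i, j)) \<in> polynomial_functions W"
    and "\<And>i j. i < p \<Longrightarrow> j < d + p \<Longrightarrow> (\<lambda>x. B x $$ (i, j)) \<in> polynomial_functions W"
  shows "(\<lambda>x. pencil_genericity p d (A x) (B x)) \<in> polynomial_functions W"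
  unfolding pencil_genericity_def
proof (intro polynomial_functions_intros polynomial_functions_det[where k = p] last_square_carrier)
  show "(\<lambda>x. last_square p d (A x) $$ (i, j)) \<in> polynomial_functions W"
    if "i < p" "j < p" for i j
    using that assms by (simp add: last_square_def)
  show "chain_mat p d (A x) (B x) \<in> carrier_mat p p" for x
    by (simp add: chain_mat_def)
  show "(\<lambda>x. chain_mat p d (A x) (B x) $$ (i, j)) \<in> polynomial_functions W"
    if "i < p" "j < p" for i j
    using that assms
    by (auto simp: chain_mat_def intro!: polynomial_functions_intros polynomial_functions_chain_vec)
qed

text \<open>On the normal form the recursion is a pure shift: \<open>A_1\<close> and its adjugate
  are the identity, and \<open>B u_(t-d)\<close> is the unit vector with index \<open>t - d\<close>,
  which \<open>u_t\<close> repeats \<open>d\<close> places further down.\<close>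

lemma chain_vec_standard:
  assumes "0 < d"
    and A: "\<And>i j. i < p \<Longrightarrow> j < d + p \<Longrightarrow> A $$ (i, j) = (if j = i + d then 1 else 0)"
    and B: "\<And>i j. i < p \<Longrightarrow> j < d + p \<Longrightarrow> B $$ (i, j) = (if j = i then 1 else 0)"
    and "t < d + p" "c < d + p"
  shows "chain_vec p d A B t $ c = (if c = t then 1 else 0)"
  using assms(4,5)
proof (induction t arbitrary: c rule: less_induct)
  case (less t)
  have L: "last_square p d A = 1\<^sub>m p"
    using A by (intro eq_matI) (auto simp: last_square_def)
  have At: "t < d \<Longrightarrow> s < p \<Longrightarrow> A $$ (s, t) = 0" for s
    using A[of s t] by auto
  have BE: "(\<Sum>r = 0..<d + p. B $$ (s, r) * chain_vec p d A B (t - d) $ r) =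
      (if s = t - d then 1 else 0)" if "s < p" "\<not> t < d" for s
  proof -
    have "(\<Sum>r = 0..<d + p. B $$ (s, r) * chain_vec p d A B (t - d) $ r) =
      (\<Sum>r = 0..<d + p. if r = s then if r = t - d then 1 else 0 else 0)"
      using that less \<open>0 < d\<close> by (intro sum.cong refl) (auto simp: B)
    then show ?thesis using that by simp
  qed
  show ?case
    using less.prems \<open>0 < d\<close>
    by (subst chain_vec.simps)
      (auto simp: L adj_mat_one At BE if_distrib[of "\<lambda>x. x * _"] cong: if_cong)
qed

text \<open>The normal form itself is the witness that the genericity polynomial does not vanish
  identically.\<close>

lemma pencil_genericity_standard:
  assumes "0 < d"
    and A: "\<And>i j. i < p \<Longrightarrow> j < d + p \<Longrightarrow> A $$ (i, j) = (if j = i + d then 1 else 0)"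
    and B: "\<And>i j. i < p \<Longrightarrow> j < d + p \<Longrightarrow> B $$ (i, j) = (if j = i then 1 else 0)"
  shows "pencil_genericity p d A B = 1"
proof -
  have "last_square p d A = 1\<^sub>m p"
    using A by (intro eq_matI) (auto simp: last_square_def)
  moreover have "chain_mat p d A B = 1\<^sub>m p"
    by (intro eq_matI)
      (auto simp: chain_mat_def chain_vec_standard[OF assms] B if_distrib[of "\<lambda>x. x * _"] cong: if_cong)
  ultimately show ?thesis
    by (simp add: pencil_genericity_def)
qed

section \<open>Shift-compatible elimination and the normal form of a rectangular pencil\<close>

definition toeplitz_eliminator :: "nat \<Rightarrow> nat \<Rightarrow> (nat \<Rightarrow> nat \<Rightarrow> complex) \<Rightarrow> nat \<Rightarrow> nat \<Rightarrow> complex" where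
  "toeplitz_eliminator p d Z s t =
    (let h = p + (t + (d - 1) * p) mod d
     in if s = t then 1 else if s < t \<and> h - (t - s) < p then - Z (h - (t - s)) (h - p) else 0)"

text \<open>
  Here \<open>h\<close> is the index in \<open>{p..<d + p}\<close> congruent to \<open>t\<close> modulo \<open>d\<close>: the column \<open>h\<close> is
  cleared and the same operation is repeated on the columns from which \<open>h\<close> is reached by
  steps of length \<open>d\<close>, so that the shift structure is kept.
\<close>

lemma toeplitz_eliminator_upper: "t < s \<Longrightarrow> toeplitz_eliminator p d Z s t = 0"
  by (simp add: toeplitz_eliminator_def Let_def)

lemma toeplitz_eliminator_diag: "toeplitz_eliminator p d Z t t = 1"
  by (simp add: toeplitz_eliminator_def Let_def)

text \<open>An entry depends only on \<open>t - s\<close> and on \<open>t\<close> modulo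
  \<open>d\<close>. Deleting the first \<open>d\<close> rows and columns therefore leaves the same
  pattern, which is what preserves the shape \<open>(0 | I)\<close> of \<open>A\<close> under the
  elimination.\<close>

lemma toeplitz_eliminator_shift:
  assumes "d \<le> t"
  shows "toeplitz_eliminator p d Z (i + d) t = toeplitz_eliminator p d Z i (t - d)"
proof -
  obtain r where r: "t = r + d"
    using assms le_Suc_ex by (metis add.commute)
  have "t + (d - 1) * p = r + (d - 1) * p + d"
    by (simp add: r)
  then have "(t + (d - 1) * p) mod d = (r + (d - 1) * p) mod d"
    by (simp only: mod_add_self2)
  then show ?thesis
    unfolding toeplitz_eliminator_def Let_def
    by (simp only: r add_diff_cancel_right add_diff_cancel_right' add_right_cancel add_less_cancel_right)
qed

lemma toeplitz_eliminator_last: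
  assumes "s < t" "p \<le> t" "t < d + p"
  shows "toeplitz_eliminator p d Z s t = (if s < p then - Z s (t - p) else 0)"
proof -
  obtain r where r: "t = p + r" "r < d"
    using assms by (metis add.commute le_add_diff_inverse nat_add_left_cancel_less)
  \<comment> \<open>In the eliminator \<open>(d - 1) * p\<close> stands for \<open>-p\<close> modulo
    \<open>d\<close>, which avoids truncated subtraction; for the last \<open>d\<close> columns it
    yields \<open>h = t\<close>.\<close>
  have eq: "t + (d - 1) * p = r + d * p"
    using r by (cases d) auto
  have "(t + (d - 1) * p) mod d = r"
    unfolding eq using r(2) by simp
  then show ?thesis
    using assms r by (auto simp: toeplitz_eliminator_def Let_def)
qed

lemma toeplitz_eliminator_det: "det (mat k k (\<lambda>(s, t). toeplitz_eliminator p d Z s t)) = 1"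
proof -
  let ?T = "mat k k (\<lambda>(s, t). toeplitz_eliminator p d Z s t)"
  have "upper_triangular ?T" by (auto simp: toeplitz_eliminator_upper)
  then have "det ?T = prod_list (diag_mat ?T)"
    by (rule det_upper_triangular) auto
  also have "diag_mat ?T = replicate k 1"
    by (auto simp: diag_mat_def toeplitz_eliminator_diag map_replicate_trivial intro!: nth_equalityI)
  finally show ?thesis by simp
qed

lemma index_mult_mat_sum:
  assumes "A \<in> carrier_mat k r" "B \<in> carrier_mat r c" "i < k" "j < c"
  shows "(A * B) $$ (i, j) = (\<Sum>t = 0..<r. A $$ (i, t) * B $$ (t, j))"
  using assms by (auto simp: scalar_prod_def)

text \<open>The rescaled chain vectors form a basis \<open>E\<close> with
  \<open>A E = (0 | C)\<close> and \<open>B E = (C | C Z)\<close>. Multiplication by the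
  shift-invariant \<open>T\<close> replaces \<open>C\<close> by \<open>C T'\<close> in both matrices
  and cancels \<open>C Z\<close>.\<close>

lemma generic_pencil_normal_form:
  assumes d: "0 < d" and A: "A \<in> carrier_mat p (d + p)" and B: "B \<in> carrier_mat p (d + p)"
    and generic: "pencil_genericity p d A B \<noteq> 0"
  obtains P Q where "P \<in> carrier_mat p p" "Q \<in> carrier_mat (d + p) (d + p)" "det P \<noteq> 0" "det Q \<noteq> 0"
    "\<And>i t. i < p \<Longrightarrow> t < d + p \<Longrightarrow> (A * Q) $$ (i, t) = (if t < d then 0 else P $$ (i, t - d))"
    "\<And>i t. i < p \<Longrightarrow> t < d + p \<Longrightarrow> (B * Q) $$ (i, t) = (if t < p then P $$ (i, t) else 0)"
proof -
  let ?q = "d + p"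
  define \<delta> where "\<delta> = det (last_square p d A)"
  have \<delta>: "\<delta> \<noteq> 0" and detC: "det (chain_mat p d A B) \<noteq> 0"
    using generic by (auto simp: pencil_genericity_def \<delta>_def)
  \<comment> \<open>Dividing \<open>u_t\<close> by one power of \<open>\<delta>\<close> for every
    step of length \<open>d\<close> removes the factor from
    \<open>A u_t = \<delta> B u_(t-d)\<close>.\<close>
  define \<sigma> where "\<sigma> t = inverse \<delta> ^ (t div d)" for t
  have \<sigma>: "\<sigma> t \<noteq> 0" for t using \<delta> by (simp add: \<sigma>_def)
  have \<sigma>_shift: "\<sigma> t * \<delta> = \<sigma> (t - d)" if "d \<le> t" for t
    using that d \<delta> by (simp add: \<sigma>_def le_div_geq)
  define E where "E = mat ?q ?q (\<lambda>(c, t). chain_vec p d A B t $ c * \<sigma> t)"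
  define G where "G i t = (\<Sum>c = 0..<?q. B $$ (i, c) * chain_vec p d A B t $ c) * \<sigma> t" for i t
  define C where "C = mat p p (\<lambda>(i, t). G i t)"
  have carr: "E \<in> carrier_mat ?q ?q" "C \<in> carrier_mat p p"
    by (auto simp: E_def C_def)
  have BE: "(B * E) $$ (i, t) = G i t" if "i < p" "t < ?q" for i t
    using that unfolding index_mult_mat_sum[OF B carr(1) that] by (simp add: E_def G_def sum_distrib_right mult.assoc)
  have AE: "(A * E) $$ (i, t) = (if t < d then 0 else G i (t - d))" if "i < p" "t < ?q" for i t
  proof -
    have "(A * E) $$ (i, t) = (\<Sum>c = 0..<?q. A $$ (i, c) * chain_vec p d A B t $ c) * \<sigma> t"
      using that unfolding index_mult_mat_sum[OF A carr(1) that] by (simp add: E_def sum_distrib_right mult.assoc)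
    then show ?thesis
      unfolding chain_vec_mult[OF d that(1)] \<delta>_def[symmetric]
      by (simp add: G_def \<sigma>_shift[symmetric] not_less mult_ac)
  qed
  have "C = chain_mat p d A B * mat_diag p \<sigma>"
    by (subst mat_diag_mult_right[of _ p]) (auto simp: C_def chain_mat_def G_def)
  then have "det C = det (chain_mat p d A B) * det (mat_diag p \<sigma>)"
    by (simp add: det_mult[of _ p] chain_mat_def mat_diag_def)
  moreover have "det (mat_diag p \<sigma>) \<noteq> 0"
  proof -
    have "det (mat_diag p \<sigma>) = prod_list (diag_mat (mat_diag p \<sigma>))"
      by (rule det_upper_triangular[of _ p]) (auto simp: mat_diag_def)
    then show ?thesis
      using \<sigma> by (auto simp: prod_list_zero_iff diag_mat_def mat_diag_def)
  qed
  ultimately have C: "det C \<noteq> 0" using detC by simp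
  \<comment> \<open>Applying \<open>A\<close> to \<open>E v = 0\<close> gives \<open>C w = 0\<close>
    for the last \<open>p\<close> coordinates \<open>w\<close> of \<open>v\<close>, so these vanish.
    The first \<open>d\<close> rows of \<open>E\<close> have a nonzero diagonal entry and zeros
    elsewhere, which disposes of the remaining coordinates.\<close>
  have E: "det E \<noteq> 0"
  proof
    assume "det E = 0"
    then obtain v where v: "v \<in> carrier_vec ?q" "v \<noteq> 0\<^sub>v ?q" "E *\<^sub>v v = 0\<^sub>v ?q"
      using det_0_iff_vec_prod_zero[OF carr(1)] by auto
    define w where "w = vec p (\<lambda>t. v $ (d + t))"
    have w: "w \<in> carrier_vec p" by (simp add: w_def)
    have "C *\<^sub>v w = (A * E) *\<^sub>v v"
    proof (rule eq_vecI)
      fix i assume i: "i < dim_vec ((A * E) *\<^sub>v v)"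
      then have i: "i < p" using A by simp
      have "((A * E) *\<^sub>v v) $ i = row (A * E) i \<bullet> v"
        using i A by (intro index_mult_mat_vec) simp
      also have "\<dots> = (\<Sum>t = 0..<?q. row (A * E) i $ t * v $ t)"
        using v(1) by (simp add: scalar_prod_def)
      also have "\<dots> = (\<Sum>t = 0..<?q. (A * E) $$ (i, t) * v $ t)"
        using i A carr(1) by (intro sum.cong refl) (simp del: index_mult_mat(1) row_mult)
      also have "\<dots> = (\<Sum>t = 0..<p. G i t * v $ (d + t))"
        using i by (simp add: sum_atLeast0_split_add AE del: index_mult_mat)
      also have "\<dots> = (C *\<^sub>v w) $ i"
        using i by (simp add: C_def w_def scalar_prod_def)
      finally show "(C *\<^sub>v w) $ i = ((A * E) *\<^sub>v v) $ i" by simp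
    qed (use A carr in auto)
    also have "\<dots> = A *\<^sub>v (E *\<^sub>v v)"
      using A carr(1) v(1) by (rule assoc_mult_mat_vec)
    also have "\<dots> = 0\<^sub>v p" using v(3) A by auto
    finally have "w = 0\<^sub>v p"
      using det_0_iff_vec_prod_zero[OF carr(2)] C w by blast
    then have low: "w $ (t - d) = 0" if "d \<le> t" "t < ?q" for t
      using that by simp
    then have high: "v $ t = 0" if "d \<le> t" "t < ?q" for t
      using that low[OF that] by (simp add: w_def)
    have "v $ c = 0" if "c < d" for c
    proof -
      have "0 = (E *\<^sub>v v) $ c" using v(3) that by simp
      also have "\<dots> = (\<Sum>t = 0..<?q. E $$ (c, t) * v $ t)"
        using that carr v(1) by (simp add: scalar_prod_def)
      also have "\<dots> = (\<Sum>t = 0..<?q. if t = c then \<delta> * \<sigma> t * v $ t else 0)"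
        using that by (intro sum.cong refl) (auto simp: E_def chain_vec_index \<delta>_def)
      also have "\<dots> = \<delta> * \<sigma> c * v $ c" using that by simp
      finally show ?thesis using \<delta> \<sigma> by simp
    qed
    with high have "v = 0\<^sub>v ?q" using v(1)
      by (intro eq_vecI) (metis index_zero_vec not_less, auto)
    with v(2) show False by simp
  qed
  obtain Cinv where Cinv: "Cinv \<in> carrier_mat p p" "C * Cinv = 1\<^sub>m p"
    using det_non_zero_imp_unit[OF carr(2) C]
    by (auto simp: Units_def ring_mat_def)
  \<comment> \<open>This is the inverse of \<open>C\<close> applied to the last \<open>d\<close>
    columns of \<open>B E\<close>, so that \<open>B E = C (I | Z)\<close>.\<close>
  define Z where "Z i c = (\<Sum>r = 0..<p. Cinv $$ (i, r) * G r (p + c))" for i c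
  have CZ: "(\<Sum>s = 0..<p. G i s * Z s c) = G i (p + c)" if "i < p" for i c
  proof -
    have one: "(\<Sum>s = 0..<p. G i s * Cinv $$ (s, r)) = (if i = r then 1 else 0)" if "r < p" for r
      using index_mult_mat_sum[OF carr(2) Cinv(1) \<open>i < p\<close> that] \<open>i < p\<close> that
      unfolding Cinv(2) by (simp add: C_def)
    have "(\<Sum>s = 0..<p. G i s * Z s c) =
      (\<Sum>r = 0..<p. (\<Sum>s = 0..<p. G i s * Cinv $$ (s, r)) * G r (p + c))"
      by (simp add: Z_def sum_distrib_left sum_distrib_right mult.assoc) (rule sum.swap)
    also have "\<dots> = (\<Sum>r = 0..<p. if i = r then G r (p + c) else 0)"
      by (intro sum.cong refl) (simp add: one)
    finally show ?thesis using that by simp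
  qed
  define \<tau> where "\<tau> = toeplitz_eliminator p d Z"
  define T where "T = mat ?q ?q (\<lambda>(s, t). \<tau> s t)"
  \<comment> \<open>By shift invariance the top left corner \<open>T'\<close> of \<open>T\<close> is
    also its bottom right corner, so the same \<open>C T'\<close> appears for \<open>A\<close> and
    for \<open>B\<close>.\<close>
  define T' where "T' = mat p p (\<lambda>(s, t). \<tau> s t)"
  have T: "T \<in> carrier_mat ?q ?q" "T' \<in> carrier_mat p p" "det T = 1" "det T' = 1"
    by (auto simp: T_def T'_def \<tau>_def toeplitz_eliminator_det)
  have CT: "(C * T') $$ (i, t) = (\<Sum>s = 0..<p. G i s * \<tau> s t)" if "i < p" "t < p" for i t
    using that unfolding index_mult_mat_sum[OF carr(2) T(2) that] by (simp add: C_def T'_def)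
  show thesis
  proof (rule that[of "C * T'" "E * T"])
    show "C * T' \<in> carrier_mat p p" "E * T \<in> carrier_mat ?q ?q"
      using carr T by auto
    show "det (C * T') \<noteq> 0" "det (E * T) \<noteq> 0"
      using C E T carr by (auto simp: det_mult)
    fix i t assume it: "i < p" "t < ?q"
    have "(A * (E * T)) $$ (i, t) = (\<Sum>s = 0..<?q. (A * E) $$ (i, s) * \<tau> s t)"
      using it unfolding assoc_mult_mat[OF A carr(1) T(1), symmetric]
        index_mult_mat_sum[OF mult_carrier_mat[OF A carr(1)] T(1) it]
      by (simp add: T_def del: index_mult_mat)
    also have "\<dots> = (\<Sum>s = 0..<p. G i s * \<tau> (d + s) t)"
      using it by (simp add: sum_atLeast0_split_add AE)
    also have "\<dots> = (if t < d then 0 else (C * T') $$ (i, t - d))"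
      using it CT[of i "t - d"]
      by (auto simp: \<tau>_def toeplitz_eliminator_upper toeplitz_eliminator_shift add.commute[of d])
    finally show "(A * (E * T)) $$ (i, t) = (if t < d then 0 else (C * T') $$ (i, t - d))" .
    have "(B * (E * T)) $$ (i, t) = (\<Sum>s = 0..<p + d. (B * E) $$ (i, s) * \<tau> s t)"
      using it unfolding assoc_mult_mat[OF B carr(1) T(1), symmetric]
        index_mult_mat_sum[OF mult_carrier_mat[OF B carr(1)] T(1) it]
      by (simp add: T_def add.commute[of p] del: index_mult_mat)
    also have "\<dots> = (\<Sum>s = 0..<p. G i s * \<tau> s t) + (\<Sum>c = 0..<d. G i (p + c) * \<tau> (p + c) t)"
      using it by (simp add: sum_atLeast0_split_add BE)
    also have "\<dots> = (if t < p then (C * T') $$ (i, t) else 0)"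
    proof (cases "t < p")
      case True
      then show ?thesis
        using it CT by (auto simp: \<tau>_def toeplitz_eliminator_upper intro!: sum.neutral)
    next
      case False
      \<comment> \<open>A column \<open>t \<ge> p\<close> of \<open>T\<close> has a column of
        \<open>- Z\<close> in its first \<open>p\<close> rows and a single 1 below them; the two
        parts contribute \<open>- G i t\<close> and \<open>G i t\<close>.\<close>
      then have "(\<Sum>s = 0..<p. G i s * \<tau> s t) = - (\<Sum>s = 0..<p. G i s * Z s (t - p))"
        using it by (simp add: \<tau>_def toeplitz_eliminator_last sum_negf)
      moreover have "(\<Sum>c = 0..<d. G i (p + c) * \<tau> (p + c) t) =
          (\<Sum>c = 0..<d. if c = t - p then G i t else 0)"
      proof (intro sum.cong refl)
        fix c assume "c \<in> {0..<d}"
        consider "p + c < t" | "p + c = t" | "t < p + c" by linarith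
        then show "G i (p + c) * \<tau> (p + c) t = (if c = t - p then G i t else 0)"
          using False it
          by cases (auto simp: \<tau>_def toeplitz_eliminator_last toeplitz_eliminator_diag
              toeplitz_eliminator_upper)
      qed
      ultimately show ?thesis
        using False it CZ[of i "t - p"] by simp
    qed
    finally show "(B * (E * T)) $$ (i, t) = (if t < p then (C * T') $$ (i, t) else 0)" .
  qed
qed

text \<open>Passing to inverse matrices in the normal form gives \<open>P A = (0 | I) Q\<close> and
  \<open>P B = (I | 0) Q\<close>. The rows of \<open>P\<close> will be basis vectors of the domain
  and the rows of \<open>Q\<close> basis vectors of the codomain.\<close>

lemma wide_pencil_rows:
  assumes lm: "l < m" and A: "A \<in> carrier_mat l m" and B: "B \<in> carrier_mat l m"
    and generic: "pencil_genericity l (m - l) A B \<noteq> 0"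
  obtains P Q where "P \<in> carrier_mat l l" "Q \<in> carrier_mat m m" "det P \<noteq> 0" "det Q \<noteq> 0"
    "\<And>t c. t < l \<Longrightarrow> c < m \<Longrightarrow> (P * A) $$ (t, c) = Q $$ (t + (m - l), c)"
    "\<And>t c. t < l \<Longrightarrow> c < m \<Longrightarrow> (P * B) $$ (t, c) = Q $$ (t, c)"
proof -
  define d where "d = m - l"
  have d: "0 < d" "d + l = m" using lm by (auto simp: d_def)
  obtain P' Q' where PQ: "P' \<in> carrier_mat l l" "Q' \<in> carrier_mat m m" "det P' \<noteq> 0" "det Q' \<noteq> 0"
    and AQ: "\<And>i t. i < l \<Longrightarrow> t < m \<Longrightarrow> (A * Q') $$ (i, t) = (if t < d then 0 else P' $$ (i, t - d))"
    and BQ: "\<And>i t. i < l \<Longrightarrow> t < m \<Longrightarrow> (B * Q') $$ (i, t) = (if t < l then P' $$ (i, t) else 0)"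
    using generic_pencil_normal_form[of d A l B] A B generic d unfolding d_def[symmetric] by metis
  obtain P where P: "P \<in> carrier_mat l l" "P * P' = 1\<^sub>m l"
    using det_non_zero_imp_unit[OF PQ(1,3)] by (auto simp: Units_def ring_mat_def)
  obtain Q where Q: "Q \<in> carrier_mat m m" "Q' * Q = 1\<^sub>m m"
    using det_non_zero_imp_unit[OF PQ(2,4)] by (auto simp: Units_def ring_mat_def)
  have detP: "det P \<noteq> 0"
    using arg_cong[OF P(2), of det] det_mult[OF P(1) PQ(1)] by auto
  have detQ: "det Q \<noteq> 0"
    using arg_cong[OF Q(2), of det] det_mult[OF PQ(2) Q(1)] by auto
  \<comment> \<open>One argument serves both matrices: \<open>M Q'\<close> has \<open>P'\<close> in
    the columns starting at \<open>e\<close> and zeros elsewhere, with \<open>e = d\<close> for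
    \<open>A\<close> and \<open>e = 0\<close> for \<open>B\<close>.\<close>
  have shift: "(P * M) $$ (t, c) = Q $$ (t + e, c)"
    if M: "M \<in> carrier_mat l m" and e: "e + l \<le> m" and t: "t < l" "c < m"
      and MQ: "\<And>i s. i < l \<Longrightarrow> s < m \<Longrightarrow> (M * Q') $$ (i, s) = (if s \<in> {e..<e + l} then P' $$ (i, s - e) else 0)"
    for M e t c
  proof -
    have PMQ: "P * (M * Q') \<in> carrier_mat l m"
      using P M PQ by auto
    have MQ': "M * Q' \<in> carrier_mat l m" using M PQ by auto
    have "P * M = P * (M * Q') * Q"
      using P M PQ Q by (simp add: assoc_mult_mat[of _ l m _ m _ m] assoc_mult_mat[of _ l l _ m _ m])
    then have "(P * M) $$ (t, c) = (\<Sum>s = 0..<m. (P * (M * Q')) $$ (t, s) * Q $$ (s, c))"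
      using index_mult_mat_sum[OF PMQ Q(1) t] by (simp only:)
    also have "\<dots> = (\<Sum>s = 0..<m. if s = t + e then Q $$ (s, c) else 0)"
    proof (intro sum.cong refl)
      fix s assume "s \<in> {0..<m}"
      then have s: "s < m" by simp
      have "(P * (M * Q')) $$ (t, s) =
          (\<Sum>i = 0..<l. P $$ (t, i) * (if s \<in> {e..<e + l} then P' $$ (i, s - e) else 0))"
        unfolding index_mult_mat_sum[OF P(1) MQ' t(1) s] by (intro sum.cong refl) (simp only: MQ s atLeastLessThan_iff)
      also have "\<dots> = (if s \<in> {e..<e + l} then (P * P') $$ (t, s - e) else 0)"
        using t(1) index_mult_mat_sum[OF P(1) PQ(1) t(1), of "s - e"] by auto
      also have "\<dots> = (if s = t + e then 1 else 0)"
        unfolding P(2) using t(1) by auto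
      finally show "(P * (M * Q')) $$ (t, s) * Q $$ (s, c) = (if s = t + e then Q $$ (s, c) else 0)"
        by simp
    qed
    also have "\<dots> = Q $$ (t + e, c)" using t e by simp
    finally show ?thesis .
  qed
  show thesis
  proof (rule that[OF P(1) Q(1) detP detQ])
    fix t c assume "t < l" "c < m"
    then show "(P * A) $$ (t, c) = Q $$ (t + (m - l), c)"
      using d by (intro shift A) (auto simp: AQ d_def[symmetric] simp del: index_mult_mat)
    show "(P * B) $$ (t, c) = Q $$ (t, c)"
      using shift[OF B, of 0 t c] \<open>t < l\<close> \<open>c < m\<close> lm by (auto simp: BQ simp del: index_mult_mat)
  qed
qed

text \<open>The transpose of \<open>A\<^sup>T Q' = (0 | P')\<close> already has the required row
  form, with the transposes of \<open>Q'\<close> and \<open>P'\<close> as the new matrices; no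
  inversion takes place, in contrast to the wide case.\<close>

lemma tall_pencil_rows:
  assumes ml: "m < l" and A: "A \<in> carrier_mat l m" and B: "B \<in> carrier_mat l m"
    and generic: "pencil_genericity m (l - m) A\<^sup>T B\<^sup>T \<noteq> 0"
  obtains P Q where "P \<in> carrier_mat l l" "Q \<in> carrier_mat m m" "det P \<noteq> 0" "det Q \<noteq> 0"
    "\<And>t c. t < l \<Longrightarrow> c < m \<Longrightarrow> (P * A) $$ (t, c) = (if t < l - m then 0 else Q $$ (t - (l - m), c))"
    "\<And>t c. t < l \<Longrightarrow> c < m \<Longrightarrow> (P * B) $$ (t, c) = (if t < m then Q $$ (t, c) else 0)"
proof -
  define d where "d = l - m"
  have d: "0 < d" "d + m = l" using ml by (auto simp: d_def)
  have "A\<^sup>T \<in> carrier_mat m l" "B\<^sup>T \<in> carrier_mat m l" using A B by auto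
  then obtain P' Q' where PQ: "P' \<in> carrier_mat m m" "Q' \<in> carrier_mat l l" "det P' \<noteq> 0" "det Q' \<noteq> 0"
    and AQ: "\<And>i t. i < m \<Longrightarrow> t < l \<Longrightarrow> (A\<^sup>T * Q') $$ (i, t) = (if t < d then 0 else P' $$ (i, t - d))"
    and BQ: "\<And>i t. i < m \<Longrightarrow> t < l \<Longrightarrow> (B\<^sup>T * Q') $$ (i, t) = (if t < m then P' $$ (i, t) else 0)"
    using generic_pencil_normal_form[of d "A\<^sup>T" m "B\<^sup>T"] generic d unfolding d_def[symmetric] by metis
  have transp: "(Q'\<^sup>T * M) $$ (t, c) = (M\<^sup>T * Q') $$ (c, t)"
    if "M \<in> carrier_mat l m" "t < l" "c < m" for M t c
  proof -
    have "Q'\<^sup>T * M = (M\<^sup>T * Q')\<^sup>T"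
      using transpose_mult[of "M\<^sup>T" m l Q' l] that(1) PQ(2) by simp
    then show ?thesis using that PQ(2) by (simp del: index_mult_mat(1))
  qed
  show thesis
    using PQ d by (intro that[of "Q'\<^sup>T" "P'\<^sup>T"])
      (auto simp: transp[OF A] transp[OF B] AQ BQ det_transpose d_def[symmetric] simp del: index_mult_mat)
qed

section \<open>Generic square pencils\<close>

text \<open>The discriminant of the characteristic polynomial of \<open>A (adj B)\<close>, which is
  proportional to \<open>A B\<^sup>-\<^sup>1\<close>.\<close>

definition square_genericity :: "nat \<Rightarrow> complex mat \<Rightarrow> complex mat \<Rightarrow> complex" where
  "square_genericity m A B = det B *
     (let \<chi> = char_poly (A * adj_mat B) in resultant_sub m (m - 1) \<chi> (pderiv \<chi>))"

text \<open>\<open>resultant_sub\<close> with the prescribed degrees \<open>m\<close> and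
  \<open>m - 1\<close> gives a Sylvester matrix whose size is the same for all \<open>x\<close>, so
  its determinant is polynomial in the entries.\<close>

lemma polynomial_functions_square_genericity:
  assumes "\<And>x. A x \<in> carrier_mat m m" "\<And>x. B x \<in> carrier_mat m m"
    and A: "\<And>i j. i < m \<Longrightarrow> j < m \<Longrightarrow> (\<lambda>x. A x $$ (i, j)) \<in> polynomial_functions W"
    and B: "\<And>i j. i < m \<Longrightarrow> j < m \<Longrightarrow> (\<lambda>x. B x $$ (i, j)) \<in> polynomial_functions W"
  shows "(\<lambda>x. square_genericity m (A x) (B x)) \<in> polynomial_functions W"
proof -
  have \<chi>: "(\<lambda>x. coeff (char_poly (A x * adj_mat (B x))) r) \<in> polynomial_functions W" for r
  proof (rule polynomial_functions_coeff_char_poly[where k = m])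
    show "A x * adj_mat (B x) \<in> carrier_mat m m" for x
      using assms(1)[of x] adj_mat(1)[OF assms(2)[of x]] by (rule mult_carrier_mat)
    show "(\<lambda>x. (A x * adj_mat (B x)) $$ (i, j)) \<in> polynomial_functions W" if "i < m" "j < m" for i j
      by (rule polynomial_functions_mult_mat[where k = m and r = m and c = m])
        (auto intro: assms that polynomial_functions_adj_mat[where k = m] adj_mat(1))
  qed
  have "(\<lambda>x. resultant_sub m (m - 1) (char_poly (A x * adj_mat (B x)))
      (pderiv (char_poly (A x * adj_mat (B x))))) \<in> polynomial_functions W"
    unfolding resultant_sub_def
  proof (rule polynomial_functions_det[where k = "m + (m - 1)"])
    fix i j assume "i < m + (m - 1)" "j < m + (m - 1)"
    then show "(\<lambda>x. sylvester_mat_sub m (m - 1) (char_poly (A x * adj_mat (B x)))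
        (pderiv (char_poly (A x * adj_mat (B x)))) $$ (i, j)) \<in> polynomial_functions W"
      by (cases "i < m - 1"; cases "i \<le> j \<and> j - i \<le> m"; cases "i - (m - 1) \<le> j \<and> j \<le> i")
        (simp_all only: sylvester_mat_sub_index if_True if_False simp_thms coeff_pderiv \<chi>
          polynomial_functions.const polynomial_functions.mult)
  qed (rule sylvester_mat_sub_carrier)
  then show ?thesis
    unfolding square_genericity_def Let_def
    by (intro polynomial_functions_intros polynomial_functions_det[where k = m] assms)
qed

text \<open>The characteristic polynomial and its derivative have exactly the degrees
  \<open>m\<close> and \<open>m - 1\<close>, so the resultant of fixed size is the genuine one. It
  vanishes exactly if the gcd is not constant, which over the complex numbers means a common
  root.\<close>

lemma square_genericity_nonzero_iff:
  assumes "0 < m" "A \<in> carrier_mat m m" "B \<in> carrier_mat m m"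
  shows "square_genericity m A B \<noteq> 0 \<longleftrightarrow> det B \<noteq> 0 \<and> rsquarefree (char_poly (A * adj_mat B))"
proof -
  let ?\<chi> = "char_poly (A * adj_mat B)"
  have deg: "degree ?\<chi> = m"
    using assms adj_mat(1)[OF assms(3)] by (intro degree_monic_char_poly[THEN conjunct1]) auto
  then have nz: "?\<chi> \<noteq> 0" using assms(1) by auto
  have "resultant_sub m (m - 1) ?\<chi> (pderiv ?\<chi>) = resultant ?\<chi> (pderiv ?\<chi>)"
    by (simp add: resultant_sub deg degree_pderiv)
  moreover have "resultant ?\<chi> (pderiv ?\<chi>) \<noteq> 0 \<longleftrightarrow> degree (gcd ?\<chi> (pderiv ?\<chi>)) = 0"
    by (simp add: resultant_0_gcd)
  moreover have "degree (gcd ?\<chi> (pderiv ?\<chi>)) = 0 \<longleftrightarrow>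
    (\<forall>a. \<not> (poly ?\<chi> a = 0 \<and> poly (pderiv ?\<chi>) a = 0))"
  proof
    assume "degree (gcd ?\<chi> (pderiv ?\<chi>)) = 0"
    then have unit: "is_unit (gcd ?\<chi> (pderiv ?\<chi>))"
      using nz by (simp add: is_unit_iff_degree)
    show "\<forall>a. \<not> (poly ?\<chi> a = 0 \<and> poly (pderiv ?\<chi>) a = 0)"
    proof (intro allI notI)
      fix a assume "poly ?\<chi> a = 0 \<and> poly (pderiv ?\<chi>) a = 0"
      then have "[:-a, 1:] dvd gcd ?\<chi> (pderiv ?\<chi>)"
        unfolding poly_eq_0_iff_dvd by (intro gcd_greatest) auto
      then have "is_unit [:-a, 1:]" using unit by (rule dvd_unit_imp_unit)
      then show False by (simp add: is_unit_iff_degree)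
    qed
  next
    assume no_root: "\<forall>a. \<not> (poly ?\<chi> a = 0 \<and> poly (pderiv ?\<chi>) a = 0)"
    show "degree (gcd ?\<chi> (pderiv ?\<chi>)) = 0"
    proof (rule ccontr)
      assume "degree (gcd ?\<chi> (pderiv ?\<chi>)) \<noteq> 0"
      then obtain a where "poly (gcd ?\<chi> (pderiv ?\<chi>)) a = 0"
        using fundamental_theorem_of_algebra[of "gcd ?\<chi> (pderiv ?\<chi>)"] by (auto simp: constant_degree)
      then have "[:-a, 1:] dvd gcd ?\<chi> (pderiv ?\<chi>)" by (simp add: poly_eq_0_iff_dvd)
      then have "poly ?\<chi> a = 0" "poly (pderiv ?\<chi>) a = 0"
        unfolding poly_eq_0_iff_dvd by (meson dvd_trans gcd_dvd1 gcd_dvd2)+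
      then show False using no_root by blast
    qed
  qed
  ultimately show ?thesis
    by (simp add: square_genericity_def Let_def rsquarefree_roots)
qed

lemma rsquarefree_prod_linear:
  fixes f :: "nat \<Rightarrow> complex"
  assumes "inj_on f {..<k}"
  shows "rsquarefree (\<Prod>i<k. [:- f i, 1:])"
  unfolding rsquarefree_roots
proof (intro allI notI)
  let ?p = "\<Prod>i<k. [:- f i, 1:]"
  fix a assume a: "poly ?p a = 0 \<and> poly (pderiv ?p) a = 0"
  then obtain j where j: "j < k" "a = f j" by (auto simp: poly_prod)
  have p: "?p = [:- f j, 1:] * (\<Prod>i\<in>{..<k} - {j}. [:- f i, 1:])"
    using j by (intro prod.remove) auto
  have "poly (pderiv ?p) a = (\<Prod>i\<in>{..<k} - {j}. f j - f i)"
    unfolding p pderiv_mult by (simp add: j pderiv_pCons poly_prod)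
  also have "\<dots> \<noteq> 0" using assms j by (auto dest: inj_onD)
  finally show False using a by simp
qed

text \<open>The witness for the square case: distinct eigenvalues \<open>0, ..., m - 1\<close>
  against the identity.\<close>

lemma square_genericity_diagonal:
  assumes "0 < m"
  shows "square_genericity m (mat_diag m of_nat) (1\<^sub>m m) \<noteq> 0"
proof -
  have diag: "mat_diag m of_nat \<in> carrier_mat m m" by (simp add: mat_diag_def)
  have "char_poly (mat_diag m of_nat :: complex mat) = (\<Prod>a\<leftarrow>diag_mat (mat_diag m of_nat). [:- a, 1:])"
    by (rule char_poly_upper_triangular[OF diag]) (auto simp: mat_diag_def)
  also have "diag_mat (mat_diag m of_nat :: complex mat) = map of_nat [0..<m]"
    by (auto simp: diag_mat_def mat_diag_def intro!: nth_equalityI)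
  also have "(\<Prod>a\<leftarrow>map of_nat [0..<m]. [:- a, 1:]) = (\<Prod>i<m. [:- (of_nat i :: complex), 1:])"
    by (simp add: o_def prod.distinct_set_conv_list[symmetric] atLeast0LessThan)
  finally have "rsquarefree (char_poly (mat_diag m of_nat :: complex mat))"
    by (simp only:) (intro rsquarefree_prod_linear inj_onI, simp)
  then show ?thesis
    by (subst square_genericity_nonzero_iff)
      (use assms diag in \<open>auto simp: adj_mat_one right_mult_one_mat[OF diag]\<close>)
qed

section \<open>Diagonalization of a generic square pencil\<close>

lemma jordan_matrix_Pair_1: "jordan_matrix (map (Pair 1) as) = mat_diag (length as) (nth as)"
proof (induction as)
  case Nil
  show ?case by (auto simp: jordan_matrix_def mat_diag_def)
next
  case (Cons a as)
  have "jordan_matrix (map (Pair 1) (a # as)) = four_block_mat (jordan_block 1 a)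
      (0\<^sub>m 1 (length as)) (0\<^sub>m (length as) 1) (mat_diag (length as) (nth as))"
    using Cons by (simp add: jordan_matrix_def Let_def mat_diag_def)
  also have "\<dots> = mat_diag (length (a # as)) (nth (a # as))"
    by (intro eq_matI) (auto simp: mat_diag_def nth_Cons')
  finally show ?case .
qed

text \<open>The pairs are sizes and eigenvalues of Jordan blocks, and the sum is the algebraic
  multiplicity of \<open>a\<close>. Multiplicity at most 1 leaves room for one block of size 1
  only.\<close>

lemma distinct_of_unit_multiplicities:
  assumes "\<And>na. na \<in> set nas \<Longrightarrow> 1 \<le> fst na"
    and "\<And>a. sum_list (map fst (filter (\<lambda>na. snd na = a) nas)) \<le> (1 :: nat)"
  shows "nas = map (Pair 1) (map snd nas) \<and> distinct (map snd nas)"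
  using assms
proof (induction nas)
  case (Cons nb nas)
  obtain n b where nb: "nb = (n, b)" by force
  have "1 \<le> n" using Cons.prems(1)[of nb] by (simp add: nb)
  moreover have sum_b: "n + sum_list (map fst (filter (\<lambda>na. snd na = b) nas)) \<le> 1"
    using Cons.prems(2)[of b] by (simp add: nb)
  ultimately have n: "n = 1" "sum_list (map fst (filter (\<lambda>na. snd na = b) nas)) = 0" by linarith+
  have "b \<notin> snd ` set nas"
  proof
    assume "b \<in> snd ` set nas"
    then obtain na where na: "na \<in> set nas" "snd na = b" by auto
    then have "fst na \<in> set (map fst (filter (\<lambda>na. snd na = b) nas))" by auto
    then have "fst na = 0" using n(2) member_le_sum_list by fastforce
    then show False using Cons.prems(1)[of na] na by auto
  qed
  moreover have "sum_list (map fst (filter (\<lambda>na. snd na = a) nas)) \<le> 1" for a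
    using Cons.prems(2)[of a] by (auto split: if_splits)
  with Cons have "nas = map (Pair 1) (map snd nas) \<and> distinct (map snd nas)" by simp
  ultimately show ?case using n by (auto simp: nb)
qed simp

text \<open>The rows of \<open>R\<close> are left eigenvectors of \<open>A * adj_mat B\<close>.
  Multiplying \<open>R A (adj B) = D R\<close> by \<open>B\<close> on the right gives
  \<open>det B * R A = D R B\<close>. Hence \<open>Q = R B\<close>, and the eigenvalues are divided
  by \<open>det B\<close>.\<close>

lemma square_pencil_rows:
  assumes m: "0 < m" and A: "A \<in> carrier_mat m m" and B: "B \<in> carrier_mat m m"
    and generic: "square_genericity m A B \<noteq> 0"
  obtains P Q e where "P \<in> carrier_mat m m" "Q \<in> carrier_mat m m" "det P \<noteq> 0" "det Q \<noteq> 0"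
    "inj_on e {..<m}"
    "\<And>t c. t < m \<Longrightarrow> c < m \<Longrightarrow> (P * A) $$ (t, c) = e t * Q $$ (t, c)"
    "\<And>t c. t < m \<Longrightarrow> c < m \<Longrightarrow> (P * B) $$ (t, c) = Q $$ (t, c)"
proof -
  let ?X = "A * adj_mat B"
  note adjB = adj_mat[OF B]
  have X: "?X \<in> carrier_mat m m" using A adjB(1) by auto
  have detB: "det B \<noteq> 0" and sqf: "rsquarefree (char_poly ?X)"
    using generic square_genericity_nonzero_iff[OF m A B] by auto
  obtain nas where nas: "jordan_nf ?X nas"
    using char_poly_factorized[OF X] jordan_nf_exists[OF X] by blast
  then have pos: "1 \<le> fst na" if "na \<in> set nas" for na
    using that by (metis image_eqI jordan_nf_def le_numeral_extra(4) less_one linorder_not_le)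
  have "sum_list (map fst (filter (\<lambda>na. snd na = a) nas)) \<le> 1" for a
    using sqf unfolding jordan_nf_order[OF nas, symmetric] rsquarefree_def
    by (metis bot_nat_0.extremum order_refl)
  from distinct_of_unit_multiplicities[of nas, OF pos this] obtain as
    where as: "nas = map (Pair 1) as" "distinct as" by blast
  obtain S R where SR: "similar_mat_wit ?X (mat_diag (length as) (nth as)) S R"
    using nas unfolding as jordan_nf_def jordan_matrix_Pair_1 similar_mat_def by blast
  have wit: "S \<in> carrier_mat m m" "R \<in> carrier_mat m m" "R * S = 1\<^sub>m m"
    "?X = S * mat_diag (length as) (nth as) * R" "mat_diag (length as) (nth as) \<in> carrier_mat m m"
    using similar_mat_witD2[OF X SR] by auto
  have len: "length as = m" using carrier_matD(1)[OF wit(5)] by (simp add: mat_diag_def)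
  define D where "D = mat_diag m (nth as)"
  have D: "D \<in> carrier_mat m m" by (simp add: D_def mat_diag_def)
  have RX: "R * ?X = D * R"
  proof -
    have "R * ?X = R * (S * (D * R))"
      unfolding wit(4) len D_def[symmetric] assoc_mult_mat[OF wit(1) D wit(2)] ..
    also have "\<dots> = (R * S) * (D * R)"
      using wit(2,1) D by (intro assoc_mult_mat[symmetric]) auto
    finally have "R * ?X = (R * S) * (D * R)" .
    then show ?thesis using wit(2) D wit(3) by auto
  qed
  have detR: "det R \<noteq> 0"
    using arg_cong[OF wit(3), of det] det_mult[OF wit(2,1)] by auto
  have "det B \<cdot>\<^sub>m (R * A) = R * (A * (adj_mat B * B))"
    using wit(2) A B adjB by (auto simp: mult_smult_distrib[of _ m m _ m] intro!: eq_matI)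
  also have "\<dots> = R * ?X * B"
    using wit(2) A B adjB(1) by (simp add: assoc_mult_mat[of _ m m _ m _ m])
  also have "\<dots> = D * (R * B)"
    unfolding RX using wit(2) B D by (simp add: assoc_mult_mat[of _ m m _ m _ m])
  finally have RA: "det B \<cdot>\<^sub>m (R * A) = D * (R * B)" .
  have RB: "R * B \<in> carrier_mat m m" using wit(2) B by auto
  show thesis
  proof (rule that[of R "R * B" "\<lambda>t. as ! t / det B"])
    show "R \<in> carrier_mat m m" "R * B \<in> carrier_mat m m" "det R \<noteq> 0" using wit RB detR by auto
    show "det (R * B) \<noteq> 0" using det_mult[OF wit(2) B] detR detB by simp
    show "inj_on (\<lambda>t. as ! t / det B) {..<m}"
      using as(2) len detB by (auto intro!: inj_onI simp: nth_eq_iff_index_eq)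
    fix t c assume tc: "t < m" "c < m"
    then have "det B * (R * A) $$ (t, c) = (D * (R * B)) $$ (t, c)"
      using arg_cong[OF RA, of "\<lambda>M. M $$ (t, c)"] wit(2) A by (simp del: index_mult_mat(1))
    also have "\<dots> = as ! t * (R * B) $$ (t, c)"
      using tc unfolding D_def mat_diag_mult_left[OF RB] by (simp del: index_mult_mat(1))
    finally show "(R * A) $$ (t, c) = as ! t / det B * (R * B) $$ (t, c)"
      using detB by (simp add: field_simps del: index_mult_mat(1))
  qed simp
qed

section \<open>Bases and block diagonal forms\<close>

lemma finsum_coordinate:
  assumes V: "vectorspace class_ring V"
    and add: "\<And>x y. x \<in> carrier V \<Longrightarrow> y \<in> carrier V \<Longrightarrow> \<phi> (x \<oplus>\<^bsub>V\<^esub> y) = \<phi> x + \<phi> y"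
    and smult: "\<And>c x. x \<in> carrier V \<Longrightarrow> \<phi> (c \<odot>\<^bsub>V\<^esub> x) = c * \<phi> x"
    and S: "finite S" and S_carr: "\<And>s. s \<in> S \<Longrightarrow> e s \<in> carrier V"
  shows "\<phi> (\<Oplus>\<^bsub>V\<^esub> s\<in>S. c s \<odot>\<^bsub>V\<^esub> e s) = (\<Sum>s\<in>S. c s * (\<phi> (e s) :: complex))"
proof -
  interpret vectorspace class_ring V by (rule V)
  have zero: "\<phi> \<zero>\<^bsub>V\<^esub> = 0"
    using smult[of "\<zero>\<^bsub>V\<^esub>" 0] smult_l_null[of "\<zero>\<^bsub>V\<^esub>"] by simp
  show ?thesis
    using S S_carr
  proof (induction S)
    case (insert s S)
    have "(\<Oplus>\<^bsub>V\<^esub> s\<in>insert s S. c s \<odot>\<^bsub>V\<^esub> e s) = c s \<odot>\<^bsub>V\<^esub> e s \<oplus>\<^bsub>V\<^esub> (\<Oplus>\<^bsub>V\<^esub> s\<in>S. c s \<odot>\<^bsub>V\<^esub> e s)"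
      using insert by (intro finsum_insert) (auto intro!: smult_closed)
    moreover have "(\<Oplus>\<^bsub>V\<^esub> s\<in>S. c s \<odot>\<^bsub>V\<^esub> e s) \<in> carrier V"
      using insert by (intro finsum_closed) (auto intro!: smult_closed)
    moreover have "c s \<odot>\<^bsub>V\<^esub> e s \<in> carrier V"
      using insert by (intro smult_closed) auto
    ultimately show ?case
      using insert by (simp add: add smult)
  qed (simp add: zero)
qed

text \<open>The functionals read off coefficients, which yields independence, and the expansion
  yields spanning; no dimension has to be computed. Duality also makes \<open>e\<close> injective,
  so the list of vectors has no repetitions.\<close>

lemma ordered_basis_of_dual_functionals:
  assumes V: "vectorspace class_ring V" and dist: "distinct idx"
    and carr: "\<And>i. i \<in> set idx \<Longrightarrow> e i \<in> carrier V"
    and add: "\<And>i x y. x \<in> carrier V \<Longrightarrow> y \<in> carrier V \<Longrightarrow> \<phi> i (x \<oplus>\<^bsub>V\<^esub> y) = \<phi> i x + \<phi> i y"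
    and smult: "\<And>i c x. x \<in> carrier V \<Longrightarrow> \<phi> i (c \<odot>\<^bsub>V\<^esub> x) = c * \<phi> i x"
    and dual: "\<And>i j. i \<in> set idx \<Longrightarrow> j \<in> set idx \<Longrightarrow> \<phi> i (e j) = (if i = j then 1 else 0)"
    and expand: "\<And>x. x \<in> carrier V \<Longrightarrow> x = (\<Oplus>\<^bsub>V\<^esub> i\<in>set idx. \<phi> i x \<odot>\<^bsub>V\<^esub> e i)"
  shows "ordered_basis V (map e idx)"
proof -
  interpret vectorspace class_ring V by (rule V)
  have inj: "inj_on e (set idx)"
    using dual by (intro inj_onI) (metis zero_neq_one)
  have lincomb: "lincomb a (e ` set idx) = (\<Oplus>\<^bsub>V\<^esub> i\<in>set idx. a (e i) \<odot>\<^bsub>V\<^esub> e i)" for a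
    unfolding lincomb_def
    by (rule finsum_reindex) (auto intro!: smult_closed carr inj)
  have "lin_indpt (e ` set idx)"
  proof (rule finite_lin_indpt2)
    fix a assume zero: "lincomb a (e ` set idx) = \<zero>\<^bsub>V\<^esub>"
    have "a (e i) = 0" if i: "i \<in> set idx" for i
    proof -
      have "\<phi> i (lincomb a (e ` set idx)) = (\<Sum>j\<in>set idx. a (e j) * \<phi> i (e j))"
        unfolding lincomb by (intro finsum_coordinate V add smult carr) auto
      also have "\<dots> = (\<Sum>j\<in>set idx. if j = i then a (e j) else 0)"
        using i by (intro sum.cong refl) (auto simp: dual)
      also have "\<dots> = a (e i)" using i by simp
      finally have "a (e i) = \<phi> i \<zero>\<^bsub>V\<^esub>" by (simp add: zero)
      also have "\<dots> = 0"
        using smult[of "\<zero>\<^bsub>V\<^esub>" i 0] smult_l_null[of "\<zero>\<^bsub>V\<^esub>"] by simp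
      finally show ?thesis .
    qed
    then show "\<forall>v\<in>e ` set idx. a v = \<zero>\<^bsub>class_ring\<^esub>" by simp
  qed (use carr in auto)
  moreover have "x \<in> span (e ` set idx)" if x: "x \<in> carrier V" for x
  proof -
    \<comment> \<open>\<open>lincomb\<close> attaches coefficients to vectors instead of indices, so
      the index is recovered by inverting \<open>e\<close>.\<close>
    have "x = lincomb (\<lambda>v. \<phi> (inv_into (set idx) e v) x) (e ` set idx)"
      unfolding lincomb
      by (subst expand[OF x], intro finsum_cong') (auto intro!: smult_closed carr simp: inj)
    then show ?thesis
      using carr by (subst finite_span) auto
  qed
  moreover have "span (e ` set idx) \<subseteq> carrier V"
    using carr by (intro span_is_subset2) auto
  ultimately have "basis (e ` set idx)"
    using carr by (auto simp: basis_def)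
  then show ?thesis
    using dist inj by (simp add: ordered_basis_def distinct_map)
qed

lemma is_matrix_of_four_block:
  assumes V: "vectorspace class_ring V"
    and A: "is_matrix_of A V us vs f" and D: "is_matrix_of D V us' vs' f"
    and vs: "set vs \<subseteq> carrier V" "set vs' \<subseteq> carrier V"
  shows "is_matrix_of (four_block_mat A (0\<^sub>m (dim_row A) (dim_col D)) (0\<^sub>m (dim_row D) (dim_col A)) D)
    V (us @ us') (vs @ vs') f"
proof -
  interpret vectorspace class_ring V by (rule V)
  let ?M = "four_block_mat A (0\<^sub>m (dim_row A) (dim_col D)) (0\<^sub>m (dim_row D) (dim_col A)) D"
  let ?r = "length vs" and ?r' = "length vs'"
  have dims: "A \<in> carrier_mat ?r (length us)" "D \<in> carrier_mat ?r' (length us')"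
    using A D by (auto simp: is_matrix_of_def)
  have split: "(\<Oplus>\<^bsub>V\<^esub> i\<in>{..<?r + k}. h i) = (\<Oplus>\<^bsub>V\<^esub> i\<in>{..<?r}. h i) \<oplus>\<^bsub>V\<^esub> (\<Oplus>\<^bsub>V\<^esub> i\<in>{..<k}. h (?r + i))"
    if "\<And>i. i < ?r + k \<Longrightarrow> h i \<in> carrier V" for h k
    using that
  proof (induction k)
    case 0
    then show ?case by (simp add: finsum_closed Pi_def)
  next
    case (Suc k)
    have "(\<Oplus>\<^bsub>V\<^esub> i\<in>{..<?r}. h i) \<in> carrier V" "(\<Oplus>\<^bsub>V\<^esub> i\<in>{..<k}. h (?r + i)) \<in> carrier V"
      "h (?r + k) \<in> carrier V"
      using Suc.prems by (auto intro!: finsum_closed)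
    then show ?case
      using Suc by (simp add: lessThan_Suc finsum_insert Pi_def a_lcomm)
  qed
  have carr: "c \<odot>\<^bsub>V\<^esub> (vs @ vs') ! i \<in> carrier V" if "i < ?r + ?r'" for c i
    using vs that by (intro smult_closed) (auto simp: nth_append subset_iff)
  have vs_carr: "i < ?r \<Longrightarrow> vs ! i \<in> carrier V" "i < ?r' \<Longrightarrow> vs' ! i \<in> carrier V" for i
    using vs by auto
  have zero: "(\<Oplus>\<^bsub>V\<^esub> i\<in>{..<k}. 0 \<odot>\<^bsub>V\<^esub> ws ! i) = \<zero>\<^bsub>V\<^esub>" if "\<And>i. i < k \<Longrightarrow> ws ! i \<in> carrier V" for ws k
  proof -
    have "(\<Oplus>\<^bsub>V\<^esub> i\<in>{..<k}. 0 \<odot>\<^bsub>V\<^esub> ws ! i) = (\<Oplus>\<^bsub>V\<^esub> i\<in>{..<k}. \<zero>\<^bsub>V\<^esub>)"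
      using that smult_l_null by (intro finsum_cong') auto
    then show ?thesis by (simp add: finsum_zero)
  qed
  have sum_vs: "(\<Oplus>\<^bsub>V\<^esub> i\<in>{..<?r}. c i \<odot>\<^bsub>V\<^esub> vs ! i) \<in> carrier V"
    "(\<Oplus>\<^bsub>V\<^esub> i\<in>{..<?r'}. c i \<odot>\<^bsub>V\<^esub> vs' ! i) \<in> carrier V" for c
    using vs_carr by (auto intro!: finsum_closed smult_closed)
  show ?thesis
    unfolding is_matrix_of_def
  proof (intro conjI allI impI)
    show "?M \<in> carrier_mat (length (vs @ vs')) (length (us @ us'))" using dims by auto
    fix j assume j: "j < length (us @ us')"
    have "(\<Oplus>\<^bsub>V\<^esub> i\<in>{..<length (vs @ vs')}. ?M $$ (i, j) \<odot>\<^bsub>V\<^esub> (vs @ vs') ! i) =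
      (\<Oplus>\<^bsub>V\<^esub> i\<in>{..<?r}. ?M $$ (i, j) \<odot>\<^bsub>V\<^esub> (vs @ vs') ! i) \<oplus>\<^bsub>V\<^esub>
      (\<Oplus>\<^bsub>V\<^esub> i\<in>{..<?r'}. ?M $$ (?r + i, j) \<odot>\<^bsub>V\<^esub> (vs @ vs') ! (?r + i))"
      unfolding length_append by (rule split) (rule carr)
    also have "(\<Oplus>\<^bsub>V\<^esub> i\<in>{..<?r}. ?M $$ (i, j) \<odot>\<^bsub>V\<^esub> (vs @ vs') ! i) =
      (\<Oplus>\<^bsub>V\<^esub> i\<in>{..<?r}. (if j < length us then A $$ (i, j) else 0) \<odot>\<^bsub>V\<^esub> vs ! i)"
      using dims j by (intro finsum_cong') (auto intro!: smult_closed vs_carr simp: nth_append)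
    also have "(\<Oplus>\<^bsub>V\<^esub> i\<in>{..<?r'}. ?M $$ (?r + i, j) \<odot>\<^bsub>V\<^esub> (vs @ vs') ! (?r + i)) =
      (\<Oplus>\<^bsub>V\<^esub> i\<in>{..<?r'}. (if j < length us then 0 else D $$ (i, j - length us)) \<odot>\<^bsub>V\<^esub> vs' ! i)"
      using dims j by (intro finsum_cong') (auto intro!: smult_closed vs_carr simp: nth_append)
    finally show "f ((us @ us') ! j) = (\<Oplus>\<^bsub>V\<^esub> i\<in>{..<length (vs @ vs')}. ?M $$ (i, j) \<odot>\<^bsub>V\<^esub> (vs @ vs') ! i)"
      using j A D sum_vs
      by (cases "j < length us") (auto simp: is_matrix_of_def nth_append zero vs_carr)
  qed
qed

lemma is_matrix_of_diag_block_mat: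
  assumes V: "vectorspace class_ring V"
    and "\<And>b ul vl. (b, ul, vl) \<in> set L \<Longrightarrow>
      is_matrix_of (M b) V (map e ul) (map g vl) f \<and> (\<forall>v\<in>set vl. g v \<in> carrier V)"
  shows "is_matrix_of (diag_block_mat (map M (map fst L))) V
    (map e (concat (map (\<lambda>x. fst (snd x)) L))) (map g (concat (map (\<lambda>x. snd (snd x)) L))) f"
  using assms(2)
proof (induction L)
  case Nil
  show ?case by (simp add: is_matrix_of_def)
next
  case (Cons x L)
  obtain b ul vl where x: "x = (b, ul, vl)" by (cases x)
  have b: "is_matrix_of (M b) V (map e ul) (map g vl) f"
    using Cons.prems[of b ul vl] by (simp add: x)
  have L: "is_matrix_of (diag_block_mat (map M (map fst L))) V
      (map e (concat (map (\<lambda>x. fst (snd x)) L))) (map g (concat (map (\<lambda>x. snd (snd x)) L))) f"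
    using Cons.prems by (intro Cons.IH) auto
  have carr: "set (map g vl) \<subseteq> carrier V" "set (map g (concat (map (\<lambda>x. snd (snd x)) L))) \<subseteq> carrier V"
    using Cons.prems by (force simp: x)+
  from is_matrix_of_four_block[OF V b L carr] show ?case
    by (simp add: x Let_def)
qed

text \<open>The matrices are checked block by block, each on the vectors recorded with it in
  \<open>L\<close>; only the basis property concerns all blocks together.\<close>

lemma has_kronecker_form_of_blocks:
  assumes V: "vectorspace class_ring V"
    and basis: "ordered_basis U (map e (concat (map (\<lambda>x. fst (snd x)) L)))"
      "ordered_basis V (map g (concat (map (\<lambda>x. snd (snd x)) L)))"
    and L: "\<And>b ul vl. (b, ul, vl) \<in> set L \<Longrightarrow> 1 \<le> block_size b \<and>
      is_matrix_of (block_A b) V (map e ul) (map g vl) A \<and>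
      is_matrix_of (block_B b) V (map e ul) (map g vl) B"
  shows "has_kronecker_form U V A B (map fst L)"
proof -
  have "set (map g (concat (map (\<lambda>x. snd (snd x)) L))) \<subseteq> carrier V"
    using basis(2) vectorspace.basis_def[OF V] by (simp add: ordered_basis_def)
  then have carr: "(b, ul, vl) \<in> set L \<Longrightarrow> \<forall>v\<in>set vl. g v \<in> carrier V" for b ul vl
    by fastforce
  show ?thesis
    unfolding has_kronecker_form_def
    using L basis carr
    by (intro conjI exI[of _ "map e (concat (map (\<lambda>x. fst (snd x)) L))"]
        exI[of _ "map g (concat (map (\<lambda>x. snd (snd x)) L))"] is_matrix_of_diag_block_mat[OF V]) auto
qed

section \<open>Row spaces of matrices\<close>

text \<open>One encoding for both spaces: \<open>w = i\<close> gives elements of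
  \<open>\<bb> n\<close>, and \<open>w = 0\<close> gives elements of \<open>Mat n m\<close>.\<close>

definition row_embed :: "nat \<Rightarrow> nat \<Rightarrow> nat \<Rightarrow> nat \<Rightarrow> (nat \<Rightarrow> complex) \<Rightarrow> complex mat" where
  "row_embed n k i w v = mat n k (\<lambda>(r, c). if r = i \<and> w \<le> c then v (c - w) else 0)"

lemma row_embed_carrier [simp]: "row_embed n k i w v \<in> carrier_mat n k"
  by (simp add: row_embed_def)

lemma finsum_mat_index:
  assumes V: "vectorspace class_ring V" and "V = (Mat n k)\<lparr>carrier := C\<rparr>" "C \<subseteq> carrier_mat n k"
    and "finite S" "\<And>s. s \<in> S \<Longrightarrow> e s \<in> C" "r < n" "c < k"
  shows "(\<Oplus>\<^bsub>V\<^esub> s\<in>S. a s \<odot>\<^bsub>V\<^esub> e s) $$ (r, c) = (\<Sum>s\<in>S. a s * e s $$ (r, c))"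
  using assms by (intro finsum_coordinate[OF V, of "\<lambda>M. M $$ (r, c)"]) (auto simp: module_mat_simps subset_iff)

text \<open>Row \<open>i\<close> ranges over a coordinate space of dimension \<open>k - w i\<close>,
  of which the rows of the invertible matrix \<open>P i\<close> are a basis; the columns of its
  inverse \<open>R i\<close> provide the dual functionals.\<close>

lemma ordered_basis_row_embed:
  assumes V: "vectorspace class_ring V"
    and VC: "V = (Mat n k)\<lparr>carrier := {Y \<in> carrier_mat n k. \<forall>r<n. \<forall>c<w r. Y $$ (r, c) = 0}\<rparr>"
    and w: "\<And>i. i < n \<Longrightarrow> w i \<le> k"
    and P: "\<And>i. i < n \<Longrightarrow> P i \<in> carrier_mat (k - w i) (k - w i)"
    and R: "\<And>i. i < n \<Longrightarrow> R i \<in> carrier_mat (k - w i) (k - w i)"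
    and PR: "\<And>i. i < n \<Longrightarrow> P i * R i = 1\<^sub>m (k - w i)"
    and RP: "\<And>i. i < n \<Longrightarrow> R i * P i = 1\<^sub>m (k - w i)"
    and idx: "distinct idx" "set idx = Sigma {..<n} (\<lambda>i. {..<k - w i})"
  shows "ordered_basis V (map (\<lambda>(i, t). row_embed n k i (w i) (\<lambda>c. P i $$ (t, c))) idx)"
proof -
  let ?e = "\<lambda>(i, t). row_embed n k i (w i) (\<lambda>c. P i $$ (t, c))"
  \<comment> \<open>The value 0 outside the index range matters: linearity is demanded for every
    index, while entries outside a matrix are unspecified.\<close>
  let ?\<phi> = "\<lambda>(i, t) Y. if i < n \<and> t < k - w i then \<Sum>s = 0..<k - w i. Y $$ (i, w i + s) * R i $$ (s, t) else 0"
  have C: "carrier V = {Y \<in> carrier_mat n k. \<forall>r<n. \<forall>c<w r. Y $$ (r, c) = 0}"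
    by (simp add: VC)
  have ops: "(\<oplus>\<^bsub>V\<^esub>) = (+)" "(\<odot>\<^bsub>V\<^esub>) = (\<cdot>\<^sub>m)" by (simp_all add: VC module_mat_simps)
  interpret vectorspace class_ring V by (rule V)
  have e: "?e it \<in> carrier V" if "it \<in> set idx" for it
  proof -
    obtain i t where it: "it = (i, t)" by force
    have "row_embed n k i (w i) (\<lambda>c. P i $$ (t, c)) $$ (r, c) = 0" if "r < n" "c < w r" for r c
      using that w[of r] by (auto simp: row_embed_def)
    then show ?thesis by (simp add: C it)
  qed
  show ?thesis
  proof (rule ordered_basis_of_dual_functionals[OF V idx(1), where \<phi> = ?\<phi>])
    show "\<And>i. i \<in> set idx \<Longrightarrow> ?e i \<in> carrier V" by (rule e)
    show "?\<phi> it (x \<oplus>\<^bsub>V\<^esub> y) = ?\<phi> it x + ?\<phi> it y" if "x \<in> carrier V" "y \<in> carrier V" for it x y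
    proof -
      obtain i t where it: "it = (i, t)" by force
      have "(x + y) $$ (i, w i + s) = x $$ (i, w i + s) + y $$ (i, w i + s)" if "i < n" "s < k - w i" for s
        using that \<open>x \<in> carrier V\<close> \<open>y \<in> carrier V\<close> by (auto simp: C)
      then show ?thesis
        by (simp add: it ops distrib_right sum.distrib)
    qed
    show "?\<phi> it (c \<odot>\<^bsub>V\<^esub> x) = c * ?\<phi> it x" if "x \<in> carrier V" for it c x
      using that by (cases it) (auto simp: C ops sum_distrib_left mult.assoc intro!: sum.cong)
    fix it jt assume mem: "it \<in> set idx" "jt \<in> set idx"
    obtain i t j s where it: "it = (i, t)" "jt = (j, s)" by force
    have lt: "i < n" "t < k - w i" "j < n" "s < k - w j" using mem by (auto simp: it idx(2))
    show "?\<phi> it (?e jt) = (if it = jt then 1 else 0)"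
    proof (cases "i = j")
      case True
      then have "?\<phi> it (?e jt) = (\<Sum>r = 0..<k - w i. P i $$ (s, r) * R i $$ (r, t))"
        using lt w[of i] by (simp add: it row_embed_def)
      also have "\<dots> = (P i * R i) $$ (s, t)"
        using lt True P[of i] R[of i] by (intro index_mult_mat_sum[symmetric]) auto
      finally show ?thesis using lt True by (auto simp: it PR)
    next
      case False
      then show ?thesis using lt w[of i] by (simp add: it row_embed_def)
    qed
  next
    fix Y assume Y: "Y \<in> carrier V"
    have carr: "(\<Oplus>\<^bsub>V\<^esub> it\<in>set idx. ?\<phi> it Y \<odot>\<^bsub>V\<^esub> ?e it) \<in> carrier V"
      using e by (intro finsum_closed) (auto intro!: smult_closed)
    show "Y = (\<Oplus>\<^bsub>V\<^esub> it\<in>set idx. ?\<phi> it Y \<odot>\<^bsub>V\<^esub> ?e it)"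
    proof (rule eq_matI)
      fix r c
      assume "r < dim_row (\<Oplus>\<^bsub>V\<^esub> it\<in>set idx. ?\<phi> it Y \<odot>\<^bsub>V\<^esub> ?e it)"
        "c < dim_col (\<Oplus>\<^bsub>V\<^esub> it\<in>set idx. ?\<phi> it Y \<odot>\<^bsub>V\<^esub> ?e it)"
      then have rc: "r < n" "c < k" using carr by (auto simp: C)
      have "(\<Oplus>\<^bsub>V\<^esub> it\<in>set idx. ?\<phi> it Y \<odot>\<^bsub>V\<^esub> ?e it) $$ (r, c) = (\<Sum>it\<in>set idx. ?\<phi> it Y * ?e it $$ (r, c))"
        using rc e by (intro finsum_mat_index[OF V VC]) (auto simp: C[symmetric] subset_iff, simp add: C)
      also have "\<dots> = (\<Sum>i<n. \<Sum>t<k - w i. ?\<phi> (i, t) Y * ?e (i, t) $$ (r, c))"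
        unfolding idx(2) by (subst sum.Sigma) (auto intro!: sum.cong)
      also have "\<dots> = (\<Sum>i<n. if i = r then \<Sum>t<k - w i. ?\<phi> (i, t) Y * ?e (i, t) $$ (r, c) else 0)"
        using rc by (intro sum.cong refl) (auto simp: row_embed_def)
      also have "\<dots> = (\<Sum>t<k - w r. ?\<phi> (r, t) Y * ?e (r, t) $$ (r, c))"
        using rc by simp
      also have "\<dots> = Y $$ (r, c)"
      proof (cases "c < w r")
        case True
        then show ?thesis using rc Y by (simp add: row_embed_def C)
      next
        case False
        have "(\<Sum>t<k - w r. ?\<phi> (r, t) Y * ?e (r, t) $$ (r, c)) =
          (\<Sum>t = 0..<k - w r. (\<Sum>s = 0..<k - w r. Y $$ (r, w r + s) * R r $$ (s, t)) * P r $$ (t, c - w r))"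
          using rc False by (intro sum.cong) (auto simp: row_embed_def)
        also have "\<dots> = (\<Sum>s = 0..<k - w r. Y $$ (r, w r + s) * (\<Sum>t = 0..<k - w r. R r $$ (s, t) * P r $$ (t, c - w r)))"
          by (simp add: sum_distrib_left sum_distrib_right mult.assoc) (rule sum.swap)
        also have "\<dots> = (\<Sum>s = 0..<k - w r. Y $$ (r, w r + s) * (if s = c - w r then 1 else 0))"
        proof (intro sum.cong refl arg_cong2[of _ _ _ _ "(*)"])
          fix s assume "s \<in> {0..<k - w r}"
          then show "(\<Sum>t = 0..<k - w r. R r $$ (s, t) * P r $$ (t, c - w r)) = (if s = c - w r then 1 else 0)"
            using rc False index_mult_mat_sum[OF R[OF rc(1)] P[OF rc(1)], of s "c - w r"] RP[OF rc(1)] by auto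
        qed
        also have "\<dots> = Y $$ (r, c)"
          using rc False by (simp add: if_distrib[of "\<lambda>x. _ * x"] cong: if_cong)
        finally show ?thesis .
      qed
      finally show "Y $$ (r, c) = (\<Oplus>\<^bsub>V\<^esub> it\<in>set idx. ?\<phi> it Y \<odot>\<^bsub>V\<^esub> ?e it) $$ (r, c)" ..
    qed (use carr Y in \<open>auto simp: C\<close>)
  qed
qed

text \<open>This is the splitting of the pencil: a matrix supported in row \<open>i\<close> from the
  diagonal on sees only the rows of \<open>X\<close> from \<open>i\<close> on, and its image stays
  in row \<open>i\<close>.\<close>

lemma row_embed_mult:
  assumes "i < n" "X \<in> carrier_mat n m"
  shows "row_embed n n i i v * X =
    row_embed n m i 0 (\<lambda>c. \<Sum>s = 0..<n - i. v s * X $$ (i + s, c))"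
proof (rule eq_matI)
  fix r c assume "r < dim_row (row_embed n m i 0 (\<lambda>c. \<Sum>s = 0..<n - i. v s * X $$ (i + s, c)))"
    "c < dim_col (row_embed n m i 0 (\<lambda>c. \<Sum>s = 0..<n - i. v s * X $$ (i + s, c)))"
  then have rc: "r < n" "c < m" by (simp_all add: row_embed_def)
  have "(row_embed n n i i v * X) $$ (r, c) = (\<Sum>s = 0..<n. row_embed n n i i v $$ (r, s) * X $$ (s, c))"
    using rc assms(2) by (intro index_mult_mat_sum) auto
  also have "\<dots> = (\<Sum>s = 0..<i + (n - i). if r = i \<and> i \<le> s then v (s - i) * X $$ (s, c) else 0)"
    using rc assms(1) by (intro sum.cong) (auto simp: row_embed_def)
  also have "\<dots> = (if r = i then \<Sum>s = 0..<n - i. v s * X $$ (i + s, c) else 0)"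
    unfolding sum_atLeast0_split_add by simp
  finally show "(row_embed n n i i v * X) $$ (r, c) =
      row_embed n m i 0 (\<lambda>c. \<Sum>s = 0..<n - i. v s * X $$ (i + s, c)) $$ (r, c)"
    using rc by (simp add: row_embed_def)
qed (use assms in \<open>auto simp: row_embed_def\<close>)

section \<open>Decomposition into chains\<close>

text \<open>For \<open>j < d\<close>, the number of \<open>t < k\<close> congruent to
  \<open>j\<close> modulo \<open>d\<close>.\<close>

definition chain_length :: "nat \<Rightarrow> nat \<Rightarrow> nat \<Rightarrow> nat" where
  "chain_length d k j = k div d + (if j < k mod d then 1 else 0)"

definition chain :: "nat \<Rightarrow> nat \<Rightarrow> nat \<Rightarrow> nat list" where
  "chain d k j = map (\<lambda>r. j + r * d) [0..<chain_length d k j]"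

lemma less_chain_length_iff:
  assumes "j < d"
  shows "r < chain_length d k j \<longleftrightarrow> j + r * d < k"
proof -
  define q s where "q = k div d" "s = k mod d"
  have k: "k = q * d + s" "s < d" using assms by (simp_all add: q_s_def)
  consider "r < q" | "r = q" | "q < r" by linarith
  then show ?thesis
  proof cases
    case 1
    then have "r * d + d \<le> q * d" by (metis Suc_leI add.commute mult_Suc mult_le_mono1)
    then show ?thesis using 1 assms k by (simp add: chain_length_def q_s_def[symmetric])
  next
    case 2
    then show ?thesis using k by (simp add: chain_length_def q_s_def[symmetric])
  next
    case 3
    then have "q * d + d \<le> r * d" by (metis Suc_leI add.commute mult_Suc mult_le_mono1)
    then show ?thesis using 3 k by (simp add: chain_length_def q_s_def[symmetric])
  qed
qed

text \<open>The source of the shape \<open>(h - 1) \<times> h\<close>: on the larger of the two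
  spaces every chain has exactly one element more.\<close>

lemma chain_length_add: "0 < d \<Longrightarrow> chain_length d (d + k) j = Suc (chain_length d k j)"
  by (simp add: chain_length_def)

lemma length_chain [simp]: "length (chain d k j) = chain_length d k j"
  by (simp add: chain_def)

lemma nth_chain [simp]: "r < chain_length d k j \<Longrightarrow> chain d k j ! r = j + r * d"
  by (simp add: chain_def)

lemma set_chain:
  assumes j: "j < d"
  shows "set (chain d k j) = {t. t < k \<and> t mod d = j}"
proof (intro Set.set_eqI iffI)
  fix t assume "t \<in> {t. t < k \<and> t mod d = j}"
  then have "t = j + (t div d) * d" "t div d < chain_length d k j"
    using j by (auto simp: less_chain_length_iff)
  then show "t \<in> set (chain d k j)" unfolding chain_def set_map set_upt
    by (intro image_eqI[of _ _ "t div d"]) simp_all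
qed (use j in \<open>auto simp: chain_def less_chain_length_iff\<close>)

lemma set_concat_chain: "0 < d \<Longrightarrow> set (concat (map (chain d k) [0..<d])) = {..<k}"
  by (auto simp: set_chain)

lemma distinct_concat_chain: "distinct (concat (map (chain d k) [0..<d]))"
proof -
  have *: "distinct (concat (map (chain d k) js))" if "distinct js" "set js \<subseteq> {..<d}" for js
    using that
  proof (induction js)
    case (Cons j js)
    then have "distinct (chain d k j)"
      by (auto simp: chain_def distinct_map intro!: inj_onI)
    moreover have "set (chain d k j) \<inter> set (chain d k j') = {}" if "j' \<in> set js" for j'
      using that Cons.prems by (auto simp: set_chain subset_iff)
    ultimately show ?case using Cons by auto
  qed simp
  show ?thesis by (rule *) auto
qed

text \<open>Exactly the residues below \<open>k mod d\<close> have one extra element, which is the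
  rule of division with remainder in \<open>balanced_indices\<close>.\<close>

lemma mset_chain_lengths:
  assumes "0 < d"
  shows "mset (map (\<lambda>j. chain_length d k j + c) [0..<d]) = balanced_indices c k d"
proof -
  let ?q = "k div d" and ?r = "k mod d"
  have "[0..<d] = [0..<?r] @ [?r..<d]"
    using assms upt_add_eq_append[of 0 ?r "d - ?r"] by simp
  moreover have "map (\<lambda>j. chain_length d k j + c) [0..<?r] = replicate ?r (?q + c + 1)"
    by (auto simp: chain_length_def intro!: nth_equalityI)
  moreover have "map (\<lambda>j. chain_length d k j + c) [?r..<d] = replicate (d - ?r) (?q + c)"
    by (auto simp: chain_length_def intro!: nth_equalityI)
  ultimately show ?thesis by (simp add: balanced_indices_def Let_def)
qed

text \<open>All columns of Kronecker blocks are unit vectors or zero, so checking such a block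
  amounts to following basis vectors.\<close>

lemma is_matrix_of_unit_columns:
  assumes V: "vectorspace class_ring V" and vs: "set vs \<subseteq> carrier V"
    and M: "M \<in> carrier_mat (length vs) (length us)"
    and cols: "\<And>j. j < length us \<Longrightarrow>
      (\<exists>s<length vs. (\<forall>i<length vs. M $$ (i, j) = (if i = s then 1 else 0)) \<and> f (us ! j) = vs ! s) \<or>
      (\<forall>i<length vs. M $$ (i, j) = 0) \<and> f (us ! j) = \<zero>\<^bsub>V\<^esub>"
  shows "is_matrix_of M V us vs f"
proof -
  interpret vectorspace class_ring V by (rule V)
  have vs_carr: "vs ! i \<in> carrier V" if "i < length vs" for i using vs that by auto
  show ?thesis
    unfolding is_matrix_of_def
  proof (intro conjI allI impI M)
    fix j assume "j < length us"
    from cols[OF this] consider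
      s where "s < length vs" "\<And>i. i < length vs \<Longrightarrow> M $$ (i, j) = (if i = s then 1 else 0)" "f (us ! j) = vs ! s"
      | "\<And>i. i < length vs \<Longrightarrow> M $$ (i, j) = 0" "f (us ! j) = \<zero>\<^bsub>V\<^esub>" by blast
    then show "f (us ! j) = (\<Oplus>\<^bsub>V\<^esub> i\<in>{..<length vs}. M $$ (i, j) \<odot>\<^bsub>V\<^esub> vs ! i)"
    proof cases
      case 1
      have "(\<Oplus>\<^bsub>V\<^esub> i\<in>{..<length vs}. M $$ (i, j) \<odot>\<^bsub>V\<^esub> vs ! i) =
        (\<Oplus>\<^bsub>V\<^esub> i\<in>{..<length vs}. if s = i then vs ! i else \<zero>\<^bsub>V\<^esub>)"
        using 1(2) vs_carr smult_l_null smult_one by (intro finsum_cong') auto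
      also have "\<dots> = vs ! s"
        using 1(1) vs_carr by (intro add.finprod_singleton) auto
      finally show ?thesis using 1(3) by simp
    next
      case 2
      have "(\<Oplus>\<^bsub>V\<^esub> i\<in>{..<length vs}. M $$ (i, j) \<odot>\<^bsub>V\<^esub> vs ! i) = (\<Oplus>\<^bsub>V\<^esub> i\<in>{..<length vs}. \<zero>\<^bsub>V\<^esub>)"
        using 2(1) vs_carr smult_l_null by (intro finsum_cong') auto
      then show ?thesis using 2(2) by (simp add: finsum_zero)
    qed
  qed
qed

section \<open>Kronecker blocks carried by chains\<close>

context
  fixes V :: "(complex, 'v) module" and e :: "nat \<Rightarrow> 'u" and g :: "nat \<Rightarrow> 'v" and f :: "'u \<Rightarrow> 'v"
    and d k j :: nat
  assumes V: "vectorspace class_ring V" and j: "j < d"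
begin

lemma is_matrix_of_horizontal_A:
  assumes f: "\<And>t. t < d + k \<Longrightarrow> f (e t) = (if t < d then \<zero>\<^bsub>V\<^esub> else g (t - d))"
    and g: "\<And>t. t < k \<Longrightarrow> g t \<in> carrier V"
  shows "is_matrix_of (horizontal_A (chain_length d (d + k) j)) V
    (map e (chain d (d + k) j)) (map g (chain d k j)) f"
proof (rule is_matrix_of_unit_columns[OF V])
  have d: "0 < d" using j by simp
  show "set (map g (chain d k j)) \<subseteq> carrier V" using g j by (auto simp: set_chain)
  show "horizontal_A (chain_length d (d + k) j) \<in>
      carrier_mat (length (map g (chain d k j))) (length (map e (chain d (d + k) j)))"
    using d by (simp add: horizontal_A_def chain_length_add)
  fix x assume "x < length (map e (chain d (d + k) j))"
  then have x: "x < Suc (chain_length d k j)" using d by (simp add: chain_length_add)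
  then have "j + x * d < d + k"
    using less_chain_length_iff[OF j, of x "d + k"] d by (simp add: chain_length_add)
  \<comment> \<open>Subtracting \<open>d\<close> moves back one position along the chain; the first
    element has no predecessor and goes to zero.\<close>
  then have "f (e (j + x * d)) = (if x = 0 then \<zero>\<^bsub>V\<^esub> else g (j + (x - 1) * d))"
    using f[of "j + x * d"] j by (cases x) auto
  then show "(\<exists>s<length (map g (chain d k j)).
      (\<forall>i<length (map g (chain d k j)). horizontal_A (chain_length d (d + k) j) $$ (i, x) = (if i = s then 1 else 0)) \<and>
      f (map e (chain d (d + k) j) ! x) = map g (chain d k j) ! s) \<or>
    (\<forall>i<length (map g (chain d k j)). horizontal_A (chain_length d (d + k) j) $$ (i, x) = 0) \<and>
      f (map e (chain d (d + k) j) ! x) = \<zero>\<^bsub>V\<^esub>"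
    using x d by (cases x) (auto simp: horizontal_A_def chain_length_add)
qed

lemma is_matrix_of_horizontal_B:
  assumes f: "\<And>t. t < d + k \<Longrightarrow> f (e t) = (if t < k then g t else \<zero>\<^bsub>V\<^esub>)"
    and g: "\<And>t. t < k \<Longrightarrow> g t \<in> carrier V"
  shows "is_matrix_of (horizontal_B (chain_length d (d + k) j)) V
    (map e (chain d (d + k) j)) (map g (chain d k j)) f"
proof (rule is_matrix_of_unit_columns[OF V])
  have d: "0 < d" using j by simp
  show "set (map g (chain d k j)) \<subseteq> carrier V" using g j by (auto simp: set_chain)
  show "horizontal_B (chain_length d (d + k) j) \<in>
      carrier_mat (length (map g (chain d k j))) (length (map e (chain d (d + k) j)))"
    using d by (simp add: horizontal_B_def chain_length_add)
  fix x assume "x < length (map e (chain d (d + k) j))"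
  then have x: "x < Suc (chain_length d k j)" using d by (simp add: chain_length_add)
  then have "j + x * d < d + k"
    using less_chain_length_iff[OF j, of x "d + k"] d by (simp add: chain_length_add)
  \<comment> \<open>Positions are kept; only the last element of the longer chain has no counterpart
    and goes to zero.\<close>
  then have "f (e (j + x * d)) = (if x < chain_length d k j then g (j + x * d) else \<zero>\<^bsub>V\<^esub>)"
    using f[of "j + x * d"] less_chain_length_iff[OF j] by simp
  then show "(\<exists>s<length (map g (chain d k j)).
      (\<forall>i<length (map g (chain d k j)). horizontal_B (chain_length d (d + k) j) $$ (i, x) = (if i = s then 1 else 0)) \<and>
      f (map e (chain d (d + k) j) ! x) = map g (chain d k j) ! s) \<or>
    (\<forall>i<length (map g (chain d k j)). horizontal_B (chain_length d (d + k) j) $$ (i, x) = 0) \<and>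
      f (map e (chain d (d + k) j) ! x) = \<zero>\<^bsub>V\<^esub>"
    using x d by (cases "x < chain_length d k j") (auto simp: horizontal_B_def chain_length_add)
qed

lemma is_matrix_of_vertical_A:
  assumes f: "\<And>t. t < k \<Longrightarrow> f (e t) = g (t + d)"
    and g: "\<And>t. t < d + k \<Longrightarrow> g t \<in> carrier V"
  shows "is_matrix_of ((horizontal_A (chain_length d (d + k) j))\<^sup>T) V
    (map e (chain d k j)) (map g (chain d (d + k) j)) f"
proof (rule is_matrix_of_unit_columns[OF V])
  have d: "0 < d" using j by simp
  show "set (map g (chain d (d + k) j)) \<subseteq> carrier V" using g j by (auto simp: set_chain)
  show "(horizontal_A (chain_length d (d + k) j))\<^sup>T \<in>
      carrier_mat (length (map g (chain d (d + k) j))) (length (map e (chain d k j)))"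
    using d by (simp add: horizontal_A_def chain_length_add)
  fix x assume "x < length (map e (chain d k j))"
  then have x: "x < chain_length d k j" by simp
  then have "f (e (j + x * d)) = g (j + Suc x * d)"
    using f[of "j + x * d"] less_chain_length_iff[OF j] by (simp add: algebra_simps)
  then show "(\<exists>s<length (map g (chain d (d + k) j)).
      (\<forall>i<length (map g (chain d (d + k) j)). (horizontal_A (chain_length d (d + k) j))\<^sup>T $$ (i, x) = (if i = s then 1 else 0)) \<and>
      f (map e (chain d k j) ! x) = map g (chain d (d + k) j) ! s) \<or>
    (\<forall>i<length (map g (chain d (d + k) j)). (horizontal_A (chain_length d (d + k) j))\<^sup>T $$ (i, x) = 0) \<and>
      f (map e (chain d k j) ! x) = \<zero>\<^bsub>V\<^esub>"
    using x d by (intro disjI1 exI[of _ "Suc x"]) (auto simp: horizontal_A_def chain_length_add)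
qed

lemma is_matrix_of_vertical_B:
  assumes f: "\<And>t. t < k \<Longrightarrow> f (e t) = g t"
    and g: "\<And>t. t < d + k \<Longrightarrow> g t \<in> carrier V"
  shows "is_matrix_of ((horizontal_B (chain_length d (d + k) j))\<^sup>T) V
    (map e (chain d k j)) (map g (chain d (d + k) j)) f"
proof (rule is_matrix_of_unit_columns[OF V])
  have d: "0 < d" using j by simp
  show "set (map g (chain d (d + k) j)) \<subseteq> carrier V" using g j by (auto simp: set_chain)
  show "(horizontal_B (chain_length d (d + k) j))\<^sup>T \<in>
      carrier_mat (length (map g (chain d (d + k) j))) (length (map e (chain d k j)))"
    using d by (simp add: horizontal_B_def chain_length_add)
  fix x assume "x < length (map e (chain d k j))"
  then have x: "x < chain_length d k j" by simp
  then have "f (e (j + x * d)) = g (j + x * d)"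
    using f[of "j + x * d"] less_chain_length_iff[OF j] by simp
  then show "(\<exists>s<length (map g (chain d (d + k) j)).
      (\<forall>i<length (map g (chain d (d + k) j)). (horizontal_B (chain_length d (d + k) j))\<^sup>T $$ (i, x) = (if i = s then 1 else 0)) \<and>
      f (map e (chain d k j) ! x) = map g (chain d (d + k) j) ! s) \<or>
    (\<forall>i<length (map g (chain d (d + k) j)). (horizontal_B (chain_length d (d + k) j))\<^sup>T $$ (i, x) = 0) \<and>
      f (map e (chain d k j) ! x) = \<zero>\<^bsub>V\<^esub>"
    using x d by (intro disjI1 exI[of _ x]) (auto simp: horizontal_B_def chain_length_add)
qed

end

lemma is_matrix_of_1x1:
  assumes "vectorspace class_ring V" "v \<in> carrier V" "M \<in> carrier_mat 1 1"
    and "f u = M $$ (0, 0) \<odot>\<^bsub>V\<^esub> v"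
  shows "is_matrix_of M V [u] [v] f"
proof -
  interpret vectorspace class_ring V by (rule assms)
  have "M $$ (0, 0) \<odot>\<^bsub>V\<^esub> v \<in> carrier V" using assms(2) by (intro smult_closed) auto
  then show ?thesis
    using assms(3,4) by (simp add: is_matrix_of_def lessThan_Suc)
qed

text \<open>
  Row \<open>n - l\<close> of an upper triangular matrix contributes an \<open>l \<times> m\<close> pencil. Each of its blocks is
  listed with the indices of the basis vectors that span its domain and its codomain.
\<close>

definition row_blocks ::
  "nat \<Rightarrow> nat \<Rightarrow> (nat \<Rightarrow> complex) \<Rightarrow> (pencil_block \<times> nat list \<times> nat list) list" where
  "row_blocks l m ev =
    (if l = m then map (\<lambda>t. (Jordan 1 (Some (ev t)), [t], [t])) [0..<m]
     else if m < l then
       map (\<lambda>j. (Horizontal (chain_length (l - m) l j), chain (l - m) l j, chain (l - m) m j)) [0..<l - m]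
     else
       map (\<lambda>j. (Vertical (chain_length (m - l) m j), chain (m - l) l j, chain (m - l) m j)) [0..<m - l])"

lemma row_blocks_domain:
  "distinct (concat (map (\<lambda>x. fst (snd x)) (row_blocks l m ev)))"
  "set (concat (map (\<lambda>x. fst (snd x)) (row_blocks l m ev))) = {..<l}"
proof -
  \<comment> \<open>With truncated subtraction \<open>(l - m) + (m - l)\<close> is the absolute
    difference, which merges the wide and the tall case.\<close>
  have eq: "concat (map (\<lambda>x. fst (snd x)) (row_blocks l m ev)) =
    (if l = m then [0..<m] else concat (map (chain ((l - m) + (m - l)) l) [0..<(l - m) + (m - l)]))"
    by (auto simp: row_blocks_def o_def)
  show "distinct (concat (map (\<lambda>x. fst (snd x)) (row_blocks l m ev)))"
    unfolding eq using distinct_concat_chain[of "(l - m) + (m - l)" l] by simp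
  show "set (concat (map (\<lambda>x. fst (snd x)) (row_blocks l m ev))) = {..<l}"
    unfolding eq using set_concat_chain[of "(l - m) + (m - l)" l]
    by (cases "l < m"; cases "m < l") (auto simp del: set_concat)
qed

lemma row_blocks_codomain:
  "distinct (concat (map (\<lambda>x. snd (snd x)) (row_blocks l m ev)))"
  "set (concat (map (\<lambda>x. snd (snd x)) (row_blocks l m ev))) = {..<m}"
proof -
  have eq: "concat (map (\<lambda>x. snd (snd x)) (row_blocks l m ev)) =
    (if l = m then [0..<m] else concat (map (chain ((l - m) + (m - l)) m) [0..<(l - m) + (m - l)]))"
    by (auto simp: row_blocks_def o_def)
  show "distinct (concat (map (\<lambda>x. snd (snd x)) (row_blocks l m ev)))"
    unfolding eq using distinct_concat_chain[of "(l - m) + (m - l)" m] by simp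
  show "set (concat (map (\<lambda>x. snd (snd x)) (row_blocks l m ev))) = {..<m}"
    unfolding eq using set_concat_chain[of "(l - m) + (m - l)" m]
    by (cases "l < m"; cases "m < l") (auto simp del: set_concat)
qed

lemma row_blocks_is_matrix_of:
  assumes V: "vectorspace class_ring V" and g: "\<And>t. t < m \<Longrightarrow> g t \<in> carrier V"
    and A: "\<And>t. t < l \<Longrightarrow> A (e t) =
      (if l < m then g (t + (m - l)) else if l = m then ev t \<odot>\<^bsub>V\<^esub> g t
       else if t < l - m then \<zero>\<^bsub>V\<^esub> else g (t - (l - m)))"
    and B: "\<And>t. t < l \<Longrightarrow> B (e t) = (if t < m then g t else \<zero>\<^bsub>V\<^esub>)"
    and L: "(b, ul, vl) \<in> set (row_blocks l m ev)" and "0 < m"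
  shows "1 \<le> block_size b \<and> is_matrix_of (block_A b) V (map e ul) (map g vl) A \<and>
    is_matrix_of (block_B b) V (map e ul) (map g vl) B"
proof -
  consider "l = m" | "m < l" | "l < m" by linarith
  then show ?thesis
  proof cases
    case 1
    then obtain t where t: "t < m" "b = Jordan 1 (Some (ev t))" "ul = [t]" "vl = [t]"
      using L by (auto simp: row_blocks_def)
    have "1 \<odot>\<^bsub>V\<^esub> g t = g t"
      using module.smult_one[OF vectorspace.axioms(1)[OF V], of "g t"] g[OF t(1)] by simp
    then show ?thesis
      using t 1 A[of t] B[of t] g[of t] by (auto intro!: is_matrix_of_1x1[OF V])
  next
    case 2
    then obtain j where j: "j < l - m" "b = Horizontal (chain_length (l - m) (l - m + m) j)"
      "ul = chain (l - m) (l - m + m) j" "vl = chain (l - m) m j"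
      using L by (auto simp: row_blocks_def)
    have "1 \<le> chain_length (l - m) (l - m + m) j"
      using chain_length_add[of "l - m" m j] j(1) by simp
    then show ?thesis
      unfolding j(2-4) block_A.simps block_B.simps block_size.simps
      using 2 j(1) A B g
      by (intro conjI is_matrix_of_horizontal_A[OF V j(1)] is_matrix_of_horizontal_B[OF V j(1)]) auto
  next
    case 3
    then obtain j where j: "j < m - l" "b = Vertical (chain_length (m - l) (m - l + l) j)"
      "ul = chain (m - l) l j" "vl = chain (m - l) (m - l + l) j"
      using L by (auto simp: row_blocks_def)
    have "1 \<le> chain_length (m - l) (m - l + l) j"
      using chain_length_add[of "m - l" l j] j(1) by simp
    then show ?thesis
      unfolding j(2-4) block_A.simps block_B.simps block_size.simps
      using 3 j(1) A B g
      by (intro conjI is_matrix_of_vertical_A[OF V j(1)] is_matrix_of_vertical_B[OF V j(1)]) auto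
  qed
qed

section \<open>The algebraic type\<close>

lemma mset_concat_map: "mset (concat (map f xs)) = (\<Sum>x\<leftarrow>xs. mset (f x))"
  by (induction xs) auto

lemma sum_list_map_concat: "(\<Sum>x\<leftarrow>concat (map h is). F x) = (\<Sum>i\<leftarrow>is. \<Sum>x\<leftarrow>h i. F x)"
  for F :: "'a \<Rightarrow> 'b :: comm_monoid_add"
  by (induction "is") auto

lemma sum_list_singleton_mset: "(\<Sum>x\<leftarrow>xs. {#h x#}) = mset (map h xs)"
  by (induction xs) auto

text \<open>Widths count indices below \<open>l = (l - m) + m\<close>, one more per chain than the
  indices below \<open>m\<close>; hence the raise by 1. Heights of vertical blocks count indices
  below \<open>m\<close> directly and are raised by 0. The \<open>case\<close> is what the
  comprehension in \<open>type_of_blocks\<close> unfolds to.\<close>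

lemma row_blocks_horizontal:
  "(\<Sum>b\<leftarrow>map fst (row_blocks l m ev). mset (case b of Horizontal h \<Rightarrow> [h] | _ \<Rightarrow> [])) =
    (if m < l then balanced_indices 1 m (l - m) else {#})"
proof (cases "m < l")
  case True
  then have "chain_length (l - m) l j = chain_length (l - m) m j + 1" for j
    using chain_length_add[of "l - m" m j] by simp
  then show ?thesis
    using True mset_chain_lengths[of "l - m" m 1]
    by (simp add: row_blocks_def o_def sum_list_singleton_mset)
next
  case False
  then show ?thesis by (simp add: row_blocks_def o_def)
qed

lemma row_blocks_vertical:
  "(\<Sum>b\<leftarrow>map fst (row_blocks l m ev). mset (case b of Vertical v \<Rightarrow> [v] | _ \<Rightarrow> [])) =
    (if l < m then balanced_indices 0 m (m - l) else {#})"
  using mset_chain_lengths[of "m - l" m 0]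
  by (simp add: row_blocks_def o_def sum_list_singleton_mset)

lemma row_blocks_sizes_at:
  assumes "inj_on ev {..<m}"
  shows "(\<Sum>b\<leftarrow>map fst (row_blocks l m ev). mset (case b of Jordan k e' \<Rightarrow> if e' = e then [k] else [] | _ \<Rightarrow> [])) =
    (if l = m \<and> e \<in> Some ` ev ` {..<m} then {#1#} else {#})"
proof (cases "l = m")
  case True
  have "(\<Sum>b\<leftarrow>map fst (row_blocks l m ev). mset (case b of Jordan k e' \<Rightarrow> if e' = e then [k] else [] | _ \<Rightarrow> [])) =
    (\<Sum>t\<leftarrow>[0..<m]. if Some (ev t) = e then {#1#} else {#})"
    using True by (simp add: row_blocks_def o_def if_distrib[of mset] cong: if_cong)
  also have "\<dots> = (\<Sum>t<m. if Some (ev t) = e then {#1#} else {#})"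
    by (simp add: sum.distinct_set_conv_list[symmetric] atLeast0LessThan)
  also have "\<dots> = (if e \<in> Some ` ev ` {..<m} then {#1#} else {#})"
  proof (cases "e \<in> Some ` ev ` {..<m}")
    case True
    then obtain t where t: "t < m" "e = Some (ev t)" by auto
    have "(\<Sum>s<m. if Some (ev s) = e then {#1#} else {#}) = (\<Sum>s<m. if s = t then {#1 :: nat#} else {#})"
      using t assms by (intro sum.cong refl) (auto dest: inj_onD)
    then show ?thesis using True t by simp
  next
    case False
    then show ?thesis by (auto intro!: sum.neutral)
  qed
  finally show ?thesis using True by simp
qed (simp add: row_blocks_def o_def)

lemma row_blocks_jordan:
  "{e. \<exists>k. Jordan k e \<in> set (map fst (row_blocks l m ev))} = (if l = m then Some ` ev ` {..<m} else {})"
  by (force simp: row_blocks_def)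

text \<open>Indices simply add up over the rows. Jordan blocks occur in the row with
  \<open>n - i = m\<close> alone, which exists exactly if \<open>m \<le> n\<close>, so injectivity
  of \<open>ev i\<close> within that row makes all \<open>m\<close> eigenvalues distinct.\<close>

lemma type_of_row_blocks:
  assumes inj: "\<And>i. i < n \<Longrightarrow> inj_on (ev i) {..<m}" and "0 < m"
  shows "type_of_blocks (concat (map (\<lambda>i. map fst (row_blocks (n - i) m (ev i))) [0..<n])) =
    \<lparr> jordan_sizes = (if m \<le> n then replicate_mset m {#1#} else {#}),
      horizontal_indices = (\<Sum>i<n. if m < n - i then balanced_indices 1 m (n - i - m) else {#}),
      vertical_indices = (\<Sum>i<n. if n - i < m then balanced_indices 0 m (m - (n - i)) else {#}) \<rparr>"
proof -
  let ?bs = "concat (map (\<lambda>i. map fst (row_blocks (n - i) m (ev i))) [0..<n])"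
  have upt: "(\<Sum>i\<leftarrow>[0..<n]. F i) = (\<Sum>i<n. F i)" for F :: "nat \<Rightarrow> nat multiset"
    by (simp add: sum.distinct_set_conv_list[symmetric] atLeast0LessThan)
  have "mset [h. Horizontal h \<leftarrow> ?bs] = (\<Sum>i<n. if m < n - i then balanced_indices 1 m (n - i - m) else {#})"
    unfolding mset_concat_map sum_list_map_concat row_blocks_horizontal upt ..
  moreover have "mset [v. Vertical v \<leftarrow> ?bs] = (\<Sum>i<n. if n - i < m then balanced_indices 0 m (m - (n - i)) else {#})"
    unfolding mset_concat_map sum_list_map_concat row_blocks_vertical upt ..
  moreover have sizes: "sizes_at ?bs e = (\<Sum>i<n. if n - i = m \<and> e \<in> Some ` ev i ` {..<m} then {#1#} else {#})" for e
    unfolding sizes_at_def mset_concat_map sum_list_map_concat upt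
    by (intro sum.cong refl row_blocks_sizes_at inj) simp
  have "set ?bs = (\<Union>i<n. set (map fst (row_blocks (n - i) m (ev i))))"
    by (simp add: atLeast0LessThan)
  then have jordan: "{e. \<exists>k. Jordan k e \<in> set ?bs} = (\<Union>i<n. if n - i = m then Some ` ev i ` {..<m} else {})"
    unfolding row_blocks_jordan[symmetric] by blast
  have "image_mset (sizes_at ?bs) (mset_set {e. \<exists>k. Jordan k e \<in> set ?bs}) =
    (if m \<le> n then replicate_mset m {#1#} else {#})"
  proof (cases "m \<le> n")
    case True
    define i where "i = n - m"
    have i: "i < n" "n - i = m" "\<And>i'. i' < n \<Longrightarrow> n - i' = m \<longleftrightarrow> i' = i"
      using True \<open>0 < m\<close> by (auto simp: i_def)
    have set: "{e. \<exists>k. Jordan k e \<in> set ?bs} = Some ` ev i ` {..<m}"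
      unfolding jordan using i by auto
    have "sizes_at ?bs e = {#1#}" if "e \<in> Some ` ev i ` {..<m}" for e
    proof -
      have "sizes_at ?bs e = (\<Sum>i'<n. if i' = i then {#1#} else {#})"
        unfolding sizes using that i by (intro sum.cong refl) auto
      then show ?thesis using i(1) by simp
    qed
    then have "image_mset (sizes_at ?bs) (mset_set (Some ` ev i ` {..<m})) =
      image_mset (\<lambda>_. {#1#}) (mset_set (Some ` ev i ` {..<m}))"
      by (intro image_mset_cong) auto
    also have "\<dots> = replicate_mset (card (Some ` ev i ` {..<m})) {#1#}"
      by (simp add: image_mset_const_eq)
    also have "card (Some ` ev i ` {..<m}) = m"
      using inj[OF i(1)] by (simp add: card_image)
    finally show ?thesis using True set by simp
  next
    case False
    then have "{e. \<exists>k. Jordan k e \<in> set ?bs} = {}"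
      unfolding jordan by auto
    then show ?thesis using False by simp
  qed
  ultimately show ?thesis
    by (simp add: type_of_blocks_def)
qed

section \<open>Reindexing and counting the indices\<close>

lemma sum_horizontal_indices:
  "(\<Sum>i<n. if m < n - i then balanced_indices 1 m (n - i - m) else {#}) =
    (\<Sum>j = 1..n - m. balanced_indices 1 m j)"
proof -
  have "(\<Sum>i<n. if m < n - i then balanced_indices 1 m (n - i - m) else {#}) =
    (\<Sum>i\<in>{i \<in> {..<n}. m < n - i}. balanced_indices 1 m (n - i - m))"
    by (rule sum.inter_filter[symmetric]) simp
  also have "\<dots> = (\<Sum>j = 1..n - m. balanced_indices 1 m j)"
    by (rule sum.reindex_bij_witness[where j = "\<lambda>i. n - i - m" and i = "\<lambda>j. n - m - j"]) auto
  finally show ?thesis .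
qed

text \<open>With \<open>l = n - i\<close>, the condition \<open>l < m\<close> cuts the range if
  \<open>m \<le> n\<close>, and \<open>j = m - l\<close> then runs up to \<open>m - 1\<close>; if
  \<open>m > n\<close> it holds for every \<open>l \<le> n\<close>.\<close>

lemma sum_vertical_indices:
  "(\<Sum>i<n. if n - i < m then balanced_indices 0 m (m - (n - i)) else {#}) =
    (if m \<le> n then \<Sum>j = 1..m - 1. balanced_indices 0 m j
     else \<Sum>j = 1..n. balanced_indices 0 m (m - j))"
proof -
  have "(\<Sum>i<n. if n - i < m then balanced_indices 0 m (m - (n - i)) else {#}) =
    (\<Sum>i\<in>{i \<in> {..<n}. n - i < m}. balanced_indices 0 m (m - (n - i)))"
    by (rule sum.inter_filter[symmetric]) simp
  also have "\<dots> = (\<Sum>l\<in>{l \<in> {1..n}. l < m}. balanced_indices 0 m (m - l))"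
    by (rule sum.reindex_bij_witness[where j = "\<lambda>i. n - i" and i = "\<lambda>l. n - l"]) auto
  also have "\<dots> = (if m \<le> n then \<Sum>j = 1..m - 1. balanced_indices 0 m j
     else \<Sum>j = 1..n. balanced_indices 0 m (m - j))"
  proof (cases "m \<le> n")
    case True
    then have "(\<Sum>l\<in>{l \<in> {1..n}. l < m}. balanced_indices 0 m (m - l)) = (\<Sum>j = 1..m - 1. balanced_indices 0 m j)"
      by (intro sum.reindex_bij_witness[where j = "\<lambda>l. m - l" and i = "\<lambda>j. m - j"]) auto
    then show ?thesis using True by simp
  next
    case False
    then have "{l \<in> {1..n}. l < m} = {1..n}" by auto
    then show ?thesis using False by simp
  qed
  finally show ?thesis .
qed

lemma size_balanced_indices: "0 < j \<Longrightarrow> size (balanced_indices c m j) = j"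
  by (simp add: balanced_indices_def Let_def less_imp_le)

lemma size_sum_balanced_indices: "size (\<Sum>j = 1..k. balanced_indices c m j) = k * (k + 1) div 2"
  by (induction k) (simp_all add: size_balanced_indices)

lemma size_sum_balanced_indices_diff:
  assumes "n < m"
  shows "size (\<Sum>j = 1..n. balanced_indices c m (m - j)) = n * m - n * (n + 1) div 2"
proof -
  \<comment> \<open>The additive form lets the induction proceed without truncated
    subtraction.\<close>
  have "size (\<Sum>j = 1..n. balanced_indices c m (m - j)) + n * (n + 1) div 2 = n * m"
    using assms
  proof (induction n)
    case (Suc n)
    have "Suc n * (Suc n + 1) div 2 = n * (n + 1) div 2 + Suc n" by simp
    then show ?case using Suc by (simp add: size_balanced_indices)
  qed simp
  then show ?thesis by linarith
qed

section \<open>The generic pencil\<close>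

definition row_genericity :: "nat \<Rightarrow> nat \<Rightarrow> complex mat \<Rightarrow> complex mat \<Rightarrow> complex" where
  "row_genericity l m A B =
    (if l < m then pencil_genericity l (m - l) A B
     else if l = m then square_genericity m A B
     else pencil_genericity m (l - m) A\<^sup>T B\<^sup>T)"

lemma invertible_of_det:
  assumes "P \<in> carrier_mat k k" "det P \<noteq> (0 :: complex)"
  shows "\<exists>R \<in> carrier_mat k k. P * R = 1\<^sub>m k \<and> R * P = 1\<^sub>m k"
  using det_non_zero_imp_unit[OF assms] by (auto simp: Units_def ring_mat_def)

text \<open>A common format for the three shapes, so that the rows can be assembled
  uniformly.\<close>

definition row_reduction ::
  "nat \<Rightarrow> nat \<Rightarrow> complex mat \<Rightarrow> complex mat \<Rightarrow> complex mat \<Rightarrow> complex mat \<Rightarrow> (nat \<Rightarrow> complex) \<Rightarrow> bool" where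
  "row_reduction l m A B P Q ev \<longleftrightarrow>
    P \<in> carrier_mat l l \<and> Q \<in> carrier_mat m m \<and> det P \<noteq> 0 \<and> det Q \<noteq> 0 \<and> inj_on ev {..<m} \<and>
    (\<forall>t<l. \<forall>c<m. (P * A) $$ (t, c) =
      (if l < m then Q $$ (t + (m - l), c) else if l = m then ev t * Q $$ (t, c)
       else if t < l - m then 0 else Q $$ (t - (l - m), c))) \<and>
    (\<forall>t<l. \<forall>c<m. (P * B) $$ (t, c) = (if t < m then Q $$ (t, c) else 0))"

lemma row_reduction_exists:
  assumes "0 < m" and A: "A \<in> carrier_mat l m" and B: "B \<in> carrier_mat l m"
    and generic: "row_genericity l m A B \<noteq> 0"
  shows "\<exists>P Q ev. row_reduction l m A B P Q ev"
proof -
  \<comment> \<open>Injectivity of \<open>ev\<close> is part of the format also for rectangular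
    pencils, whose equations do not mention it; \<open>of_nat\<close> fills the place.\<close>
  have inj: "inj_on (of_nat :: nat \<Rightarrow> complex) {..<m}" by (simp add: inj_on_def)
  consider "l < m" | "l = m" | "m < l" by linarith
  then show ?thesis
  proof cases
    case 1
    then have "pencil_genericity l (m - l) A B \<noteq> 0" using generic by (simp add: row_genericity_def)
    from wide_pencil_rows[OF 1 A B this] obtain P Q where
      "P \<in> carrier_mat l l" "Q \<in> carrier_mat m m" "det P \<noteq> 0" "det Q \<noteq> 0"
      "\<And>t c. t < l \<Longrightarrow> c < m \<Longrightarrow> (P * A) $$ (t, c) = Q $$ (t + (m - l), c)"
      "\<And>t c. t < l \<Longrightarrow> c < m \<Longrightarrow> (P * B) $$ (t, c) = Q $$ (t, c)" by blast
    then have "row_reduction l m A B P Q of_nat"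
      using 1 inj by (simp add: row_reduction_def del: index_mult_mat(1))
    then show ?thesis by blast
  next
    case 2
    have A': "A \<in> carrier_mat m m" and B': "B \<in> carrier_mat m m" using A B 2 by auto
    have "square_genericity m A B \<noteq> 0" using generic 2 by (simp add: row_genericity_def)
    from square_pencil_rows[OF \<open>0 < m\<close> A' B' this] obtain P Q ev where
      "P \<in> carrier_mat m m" "Q \<in> carrier_mat m m" "det P \<noteq> 0" "det Q \<noteq> 0" "inj_on ev {..<m}"
      "\<And>t c. t < m \<Longrightarrow> c < m \<Longrightarrow> (P * A) $$ (t, c) = ev t * Q $$ (t, c)"
      "\<And>t c. t < m \<Longrightarrow> c < m \<Longrightarrow> (P * B) $$ (t, c) = Q $$ (t, c)" by blast
    then have "row_reduction l m A B P Q ev"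
      using 2 by (simp add: row_reduction_def del: index_mult_mat(1))
    then show ?thesis by blast
  next
    case 3
    then have "pencil_genericity m (l - m) A\<^sup>T B\<^sup>T \<noteq> 0" using generic by (simp add: row_genericity_def)
    from tall_pencil_rows[OF 3 A B this] obtain P Q where
      "P \<in> carrier_mat l l" "Q \<in> carrier_mat m m" "det P \<noteq> 0" "det Q \<noteq> 0"
      "\<And>t c. t < l \<Longrightarrow> c < m \<Longrightarrow> (P * A) $$ (t, c) = (if t < l - m then 0 else Q $$ (t - (l - m), c))"
      "\<And>t c. t < l \<Longrightarrow> c < m \<Longrightarrow> (P * B) $$ (t, c) = (if t < m then Q $$ (t, c) else 0)" by blast
    then have "row_reduction l m A B P Q of_nat"
      using 3 inj by (simp add: row_reduction_def del: index_mult_mat(1))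
    then show ?thesis by blast
  qed
qed

text \<open>The size is fixed for every \<open>X\<close>, even outside the carrier, as the lemmas on
  polynomial functions ask for dimensions at all arguments.\<close>

definition bottom_rows :: "nat \<Rightarrow> nat \<Rightarrow> nat \<Rightarrow> complex mat \<Rightarrow> complex mat" where
  "bottom_rows n m i X = mat (n - i) m (\<lambda>(r, c). X $$ (i + r, c))"

lemma bottom_rows_carrier [simp]: "bottom_rows n m i X \<in> carrier_mat (n - i) m"
  by (simp add: bottom_rows_def)

lemma standard_sum_row_embed:
  assumes "i < n" "X \<in> carrier_mat n m" "P \<in> carrier_mat (n - i) (n - i)" "t < n - i"
    and w: "\<And>c. c < m \<Longrightarrow> (P * bottom_rows n m i X) $$ (t, c) = w c"
  shows "standard_sum (row_embed n n i i (\<lambda>c. P $$ (t, c))) X = row_embed n m i 0 w"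
proof -
  have "(\<Sum>s = 0..<n - i. P $$ (t, s) * X $$ (i + s, c)) = w c" if "c < m" for c
    using index_mult_mat_sum[OF assms(3) bottom_rows_carrier assms(4) that, of X] w[OF that] that
    by (simp add: bottom_rows_def)
  then show ?thesis
    unfolding standard_sum_def row_embed_mult[OF assms(1,2)] by (auto simp: row_embed_def)
qed

lemma generic_pencil_type:
  assumes m: "0 < m" and a: "a \<in> carrier_mat n m" and b: "b \<in> carrier_mat n m"
    and generic: "\<And>i. i < n \<Longrightarrow> row_genericity (n - i) m (bottom_rows n m i a) (bottom_rows n m i b) \<noteq> 0"
  shows "has_algebraic_type (\<bb> n) (Mat n m) (\<lambda>\<xi>. standard_sum \<xi> a) (\<lambda>\<xi>. standard_sum \<xi> b)
    \<lparr> jordan_sizes = (if m \<le> n then replicate_mset m {#1#} else {#}),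
      horizontal_indices = (\<Sum>j = 1..n - m. balanced_indices 1 m j),
      vertical_indices = (if m \<le> n then \<Sum>j = 1..m - 1. balanced_indices 0 m j
        else \<Sum>j = 1..n. balanced_indices 0 m (m - j)) \<rparr>"
proof -
  have "\<exists>P Q ev. row_reduction (n - i) m (bottom_rows n m i a) (bottom_rows n m i b) P Q ev" if "i < n" for i
    by (rule row_reduction_exists[OF m bottom_rows_carrier bottom_rows_carrier generic[OF that]])
  then obtain P Q ev where
    red: "\<And>i. i < n \<Longrightarrow> row_reduction (n - i) m (bottom_rows n m i a) (bottom_rows n m i b) (P i) (Q i) (ev i)"
    by metis
  have PQ: "i < n \<Longrightarrow> P i \<in> carrier_mat (n - i) (n - i)" "i < n \<Longrightarrow> Q i \<in> carrier_mat m m"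
    "i < n \<Longrightarrow> det (P i) \<noteq> 0" "i < n \<Longrightarrow> det (Q i) \<noteq> 0" and inj: "i < n \<Longrightarrow> inj_on (ev i) {..<m}" for i
    using red[of i] by (auto simp: row_reduction_def)
  have Pa: "(P i * bottom_rows n m i a) $$ (t, c) =
      (if n - i < m then Q i $$ (t + (m - (n - i)), c) else if n - i = m then ev i t * Q i $$ (t, c)
       else if t < n - i - m then 0 else Q i $$ (t - (n - i - m), c))"
    and Pb: "(P i * bottom_rows n m i b) $$ (t, c) = (if t < m then Q i $$ (t, c) else 0)"
    if "i < n" "t < n - i" "c < m" for i t c
    using red[OF that(1)] that(2,3) unfolding row_reduction_def by blast+
  obtain R where R: "\<And>i. i < n \<Longrightarrow> R i \<in> carrier_mat (n - i) (n - i)"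
    "\<And>i. i < n \<Longrightarrow> P i * R i = 1\<^sub>m (n - i)" "\<And>i. i < n \<Longrightarrow> R i * P i = 1\<^sub>m (n - i)"
    using invertible_of_det[OF PQ(1,3)] by metis
  obtain S where S: "\<And>i. i < n \<Longrightarrow> S i \<in> carrier_mat m m"
    "\<And>i. i < n \<Longrightarrow> Q i * S i = 1\<^sub>m m" "\<And>i. i < n \<Longrightarrow> S i * Q i = 1\<^sub>m m"
    using invertible_of_det[OF PQ(2,4)] by metis
  define e where "e = (\<lambda>(i, t). row_embed n n i i (\<lambda>c. P i $$ (t, c)))"
  define g where "g = (\<lambda>(i, t). row_embed n m i 0 (\<lambda>c. Q i $$ (t, c)))"
  \<comment> \<open>Tagging positions with the row number \<open>i\<close> keeps the basis vectors
    of different rows apart.\<close>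
  define L where "L = concat (map (\<lambda>i. map (\<lambda>(b, ul, vl). (b, map (Pair i) ul, map (Pair i) vl))
    (row_blocks (n - i) m (ev i))) [0..<n])"
  have concat_fst: "concat (map (\<lambda>x. fst (snd x))
      (concat (map (\<lambda>i. map (\<lambda>(b, ul, vl). (b, map (Pair i) ul, map (Pair i) vl)) (h i)) is))) =
    concat (map (\<lambda>i. map (Pair i) (concat (map (\<lambda>x. fst (snd x)) (h i)))) is)"
    for "is" and h :: "nat \<Rightarrow> (pencil_block \<times> nat list \<times> nat list) list"
    by (induction "is") (auto simp: map_concat o_def case_prod_unfold)
  have concat_snd: "concat (map (\<lambda>x. snd (snd x))
      (concat (map (\<lambda>i. map (\<lambda>(b, ul, vl). (b, map (Pair i) ul, map (Pair i) vl)) (h i)) is))) =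
    concat (map (\<lambda>i. map (Pair i) (concat (map (\<lambda>x. snd (snd x)) (h i)))) is)"
    for "is" and h :: "nat \<Rightarrow> (pencil_block \<times> nat list \<times> nat list) list"
    by (induction "is") (auto simp: map_concat o_def case_prod_unfold)
  have distinct_pairs: "distinct (concat (map (\<lambda>i. map (Pair i) (h i)) is))"
    if "distinct is" "\<And>i. distinct (h i)" for "is" and h :: "nat \<Rightarrow> nat list"
    using that by (induction "is") (auto simp: distinct_map inj_on_def)
  have set_pairs: "set (concat (map (\<lambda>i. map (Pair i) (h i)) is)) = Sigma (set is) (\<lambda>i. set (h i))"
    for "is" and h :: "nat \<Rightarrow> nat list"
    by auto
  have basis_U: "ordered_basis (\<bb> n) (map e (concat (map (\<lambda>x. fst (snd x)) L)))"
    unfolding e_def L_def concat_fst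
  proof (rule ordered_basis_row_embed[where R = R])
    show "vectorspace class_ring (\<bb> n)" by (rule vectorspace_upper_triangular)
    \<comment> \<open>Upper triangularity is the case \<open>w i = i\<close> of the row spaces: row
      \<open>i\<close> begins at the diagonal.\<close>
    show "\<bb> n = (Mat n n)\<lparr>carrier := {Y \<in> carrier_mat n n. \<forall>r<n. \<forall>c<r. Y $$ (r, c) = 0}\<rparr>"
      unfolding upper_triangular_algebra_def upper_triangular_def
      by (intro arg_cong[of _ _ "\<lambda>C. (Mat n n)\<lparr>carrier := C\<rparr>"]) auto
    show "distinct (concat (map (\<lambda>i. map (Pair i) (concat (map (\<lambda>x. fst (snd x)) (row_blocks (n - i) m (ev i))))) [0..<n]))"
      by (rule distinct_pairs) (simp_all only: distinct_upt row_blocks_domain)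
    show "set (concat (map (\<lambda>i. map (Pair i) (concat (map (\<lambda>x. fst (snd x)) (row_blocks (n - i) m (ev i))))) [0..<n])) =
        Sigma {..<n} (\<lambda>i. {..<n - i})"
      unfolding set_pairs row_blocks_domain by auto
  qed (use PQ R in auto)
  have basis_V: "ordered_basis (Mat n m) (map g (concat (map (\<lambda>x. snd (snd x)) L)))"
    unfolding g_def L_def concat_snd
  proof (rule ordered_basis_row_embed[where R = S and w = "\<lambda>_. 0"])
    show "vectorspace class_ring (Mat n m)" by (rule vectorspace_Mat)
    show "Mat n m = (Mat n m)\<lparr>carrier := {Y \<in> carrier_mat n m. \<forall>r<n. \<forall>c<0. Y $$ (r, c) = 0}\<rparr>"
      by (simp add: module_mat_def)
    show "distinct (concat (map (\<lambda>i. map (Pair i) (concat (map (\<lambda>x. snd (snd x)) (row_blocks (n - i) m (ev i))))) [0..<n]))"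
      by (rule distinct_pairs) (simp_all only: distinct_upt row_blocks_codomain)
    show "set (concat (map (\<lambda>i. map (Pair i) (concat (map (\<lambda>x. snd (snd x)) (row_blocks (n - i) m (ev i))))) [0..<n])) =
        Sigma {..<n} (\<lambda>i. {..<m - 0})"
      unfolding set_pairs row_blocks_codomain by auto
  qed (use PQ S in auto)
  have "has_kronecker_form (\<bb> n) (Mat n m) (\<lambda>\<xi>. standard_sum \<xi> a) (\<lambda>\<xi>. standard_sum \<xi> b) (map fst L)"
  proof (rule has_kronecker_form_of_blocks[OF vectorspace_Mat basis_U basis_V])
    fix bl ul vl assume "(bl, ul, vl) \<in> set L"
    then obtain i ul' vl' where i: "i < n" and blocks: "(bl, ul', vl') \<in> set (row_blocks (n - i) m (ev i))"
      and ul: "ul = map (Pair i) ul'" "vl = map (Pair i) vl'"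
      by (auto simp: L_def)
    \<comment> \<open>Zero and scalar multiples are again embedded rows, so the equations between
      vectors reduce to the entries given by \<open>row_reduction\<close>.\<close>
    have zero: "\<zero>\<^bsub>Mat n m\<^esub> = row_embed n m i 0 (\<lambda>_. 0)"
      by (auto simp: module_mat_simps row_embed_def)
    have smult: "c \<odot>\<^bsub>Mat n m\<^esub> row_embed n m i 0 v = row_embed n m i 0 (\<lambda>s. c * v s)" for c v
      by (auto simp: module_mat_simps row_embed_def)
    have "1 \<le> block_size bl \<and>
      is_matrix_of (block_A bl) (Mat n m) (map (\<lambda>t. e (i, t)) ul') (map (\<lambda>t. g (i, t)) vl') (\<lambda>\<xi>. standard_sum \<xi> a) \<and>
      is_matrix_of (block_B bl) (Mat n m) (map (\<lambda>t. e (i, t)) ul') (map (\<lambda>t. g (i, t)) vl') (\<lambda>\<xi>. standard_sum \<xi> b)"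
    proof (rule row_blocks_is_matrix_of[OF vectorspace_Mat _ _ _ blocks m])
      show "g (i, t) \<in> carrier (Mat n m)" for t
        by (simp add: g_def module_mat_simps)
      fix t assume t: "t < n - i"
      note rows = standard_sum_row_embed[OF i _ PQ(1)[OF i] t]
      have "standard_sum (e (i, t)) a = row_embed n m i 0 (\<lambda>c.
        if n - i < m then Q i $$ (t + (m - (n - i)), c) else if n - i = m then ev i t * Q i $$ (t, c)
        else if t < n - i - m then 0 else Q i $$ (t - (n - i - m), c))"
        unfolding e_def prod.case by (rule rows[OF a Pa[OF i t]])
      then show "standard_sum (e (i, t)) a =
        (if n - i < m then g (i, t + (m - (n - i))) else if n - i = m then ev i t \<odot>\<^bsub>Mat n m\<^esub> g (i, t)
         else if t < n - i - m then \<zero>\<^bsub>Mat n m\<^esub> else g (i, t - (n - i - m)))"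
        unfolding g_def prod.case zero smult by simp
      have "standard_sum (e (i, t)) b = row_embed n m i 0 (\<lambda>c. if t < m then Q i $$ (t, c) else 0)"
        unfolding e_def prod.case by (rule rows[OF b Pb[OF i t]])
      then show "standard_sum (e (i, t)) b = (if t < m then g (i, t) else \<zero>\<^bsub>Mat n m\<^esub>)"
        unfolding g_def prod.case zero by simp
    qed
    then show "1 \<le> block_size bl \<and>
      is_matrix_of (block_A bl) (Mat n m) (map e ul) (map g vl) (\<lambda>\<xi>. standard_sum \<xi> a) \<and>
      is_matrix_of (block_B bl) (Mat n m) (map e ul) (map g vl) (\<lambda>\<xi>. standard_sum \<xi> b)"
      by (simp add: ul o_def)
  qed
  moreover have "map fst L = concat (map (\<lambda>i. map fst (row_blocks (n - i) m (ev i))) [0..<n])"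
    by (simp add: L_def map_concat o_def case_prod_unfold)
  ultimately show ?thesis
    unfolding has_algebraic_type_def sum_horizontal_indices[symmetric] sum_vertical_indices[symmetric]
    using type_of_row_blocks[of n ev m, OF inj m] by (intro exI[of _ "map fst L"] conjI) (simp_all only:)
qed

section \<open>The Zariski open set of generic pairs\<close>

lemma vectorspace_pairs: "Module.module class_ring (direct_sum (Mat n m) (Mat n m))"
  using vectorspace_Mat by (intro direct_sum_is_module) (auto simp: vectorspace_def)

lemma polynomial_functions_entries:
  assumes "r < n" "c < m"
  shows "(\<lambda>x. fst x $$ (r, c)) \<in> polynomial_functions (direct_sum (Mat n m) (Mat n m))"
    and "(\<lambda>x. snd x $$ (r, c)) \<in> polynomial_functions (direct_sum (Mat n m) (Mat n m))"
  using assms by (auto intro!: polynomial_functions.linear simp: direct_sum_def module_mat_simps)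

lemma polynomial_functions_row_genericity:
  assumes "i < n"
  shows "(\<lambda>x. row_genericity (n - i) m (bottom_rows n m i (fst x)) (bottom_rows n m i (snd x)))
    \<in> polynomial_functions (direct_sum (Mat n m) (Mat n m))"
proof -
  have entries: "(\<lambda>x. bottom_rows n m i (fst x) $$ (r, c)) \<in> polynomial_functions (direct_sum (Mat n m) (Mat n m))"
    "(\<lambda>x. bottom_rows n m i (snd x) $$ (r, c)) \<in> polynomial_functions (direct_sum (Mat n m) (Mat n m))"
    if "r < n - i" "c < m" for r c
    using that by (auto simp: bottom_rows_def intro!: polynomial_functions_entries)
  have dims: "dim_row (bottom_rows n m i X) = n - i" "dim_col (bottom_rows n m i X) = m" for X
    by (simp_all add: bottom_rows_def)
  consider "n - i < m" | "n - i = m" | "m < n - i" by linarith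
  then show ?thesis
  proof cases
    case 1
    then show ?thesis
      unfolding row_genericity_def by (simp, intro polynomial_functions_pencil_genericity entries) auto
  next
    case 2
    then show ?thesis
      unfolding row_genericity_def
      by (simp, intro polynomial_functions_square_genericity entries)
        (use bottom_rows_carrier[of n m i] in auto)
  next
    case 3
    then show ?thesis
      unfolding row_genericity_def
      by (simp, intro polynomial_functions_pencil_genericity) (auto simp: dims entries)
  qed
qed

text \<open>Each row may use its own witness, namely the normal form of its shape, placed in the
  bottom rows and padded with zeros above.\<close>

lemma row_genericity_nonzero:
  assumes "i < n" "0 < m"
  shows "\<exists>x\<in>carrier (direct_sum (Mat n m) (Mat n m)).
    row_genericity (n - i) m (bottom_rows n m i (fst x)) (bottom_rows n m i (snd x)) \<noteq> 0"
proof -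
  define l where "l = n - i"
  have "\<exists>A B. A \<in> carrier_mat l m \<and> B \<in> carrier_mat l m \<and> row_genericity l m A B \<noteq> 0"
  proof -
    consider "l < m" | "l = m" | "m < l" by linarith
    then show ?thesis
    proof cases
      case 1
      let ?A = "mat l m (\<lambda>(r, c). if c = r + (m - l) then 1 else 0) :: complex mat"
      let ?B = "mat l m (\<lambda>(r, c). if c = r then 1 else 0) :: complex mat"
      have "pencil_genericity l (m - l) ?A ?B = 1"
        using 1 by (intro pencil_genericity_standard) auto
      then show ?thesis
        using 1 by (intro exI[of _ ?A] exI[of _ ?B]) (simp add: row_genericity_def)
    next
      case 2
      then show ?thesis
        using square_genericity_diagonal[OF \<open>0 < m\<close>]
        by (intro exI[of _ "mat_diag m of_nat"] exI[of _ "1\<^sub>m m"]) (simp add: row_genericity_def mat_diag_def)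
    next
      case 3
      let ?A = "mat l m (\<lambda>(r, c). if r = c + (l - m) then 1 else 0) :: complex mat"
      let ?B = "mat l m (\<lambda>(r, c). if r = c then 1 else 0) :: complex mat"
      have "pencil_genericity m (l - m) ?A\<^sup>T ?B\<^sup>T = 1"
        using 3 by (intro pencil_genericity_standard) auto
      then show ?thesis
        using 3 by (intro exI[of _ ?A] exI[of _ ?B]) (simp add: row_genericity_def)
    qed
  qed
  then obtain A B where AB: "A \<in> carrier_mat l m" "B \<in> carrier_mat l m" "row_genericity l m A B \<noteq> 0"
    by blast
  define ext where "ext X = mat n m (\<lambda>(r, c). if i \<le> r then X $$ (r - i, c) else 0)" for X :: "complex mat"
  have ext: "bottom_rows n m i (ext X) = X" if "X \<in> carrier_mat l m" for X
    using that by (intro eq_matI) (auto simp: bottom_rows_def ext_def l_def)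
  show ?thesis
    using AB by (intro bexI[of _ "(ext A, ext B)"])
      (auto simp: ext l_def[symmetric], simp add: ext_def direct_sum_def module_mat_simps)
qed

lemma has_JK_invariants_standard_sum:
  assumes m: "0 < m"
  shows "has_JK_invariants (\<bb> n) (Mat n m) standard_sum
    \<lparr> jordan_sizes = (if m \<le> n then replicate_mset m {#1#} else {#}),
      horizontal_indices = (\<Sum>j = 1..n - m. balanced_indices 1 m j),
      vertical_indices = (if m \<le> n then \<Sum>j = 1..m - 1. balanced_indices 0 m j
        else \<Sum>j = 1..n. balanced_indices 0 m (m - j)) \<rparr>"
    (is "has_JK_invariants _ _ _ ?T")
proof -
  let ?W = "direct_sum (Mat n m) (Mat n m)"
  let ?f = "\<lambda>i x. row_genericity (n - i) m (bottom_rows n m i (fst x)) (bottom_rows n m i (snd x))"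
  \<comment> \<open>One product of all row conditions defines the open set, which is nonempty
    because no factor vanishes identically.\<close>
  define S where "S = {x \<in> carrier ?W. (\<Prod>i<n. ?f i x) \<noteq> 0}"
  have "(\<lambda>x. \<Prod>i<n. ?f i x) \<in> polynomial_functions ?W"
    by (intro polynomial_functions_prod polynomial_functions_row_genericity) simp
  then have "zariski_open ?W S"
    unfolding zariski_open_def S_def by (intro exI[of _ "{\<lambda>x. \<Prod>i<n. ?f i x}"]) auto
  moreover have "\<exists>x\<in>carrier ?W. (\<Prod>i<n. ?f i x) \<noteq> 0"
    by (intro polynomial_functions_prod_nonzero[OF vectorspace_pairs] polynomial_functions_row_genericity
        row_genericity_nonzero m) auto
  then have "S \<noteq> {}" unfolding S_def by blast
  moreover have "has_algebraic_type (\<bb> n) (Mat n m) (\<lambda>\<xi>. standard_sum \<xi> a) (\<lambda>\<xi>. standard_sum \<xi> b) ?T"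
    if "(a, b) \<in> S" for a b
    using that by (intro generic_pencil_type m) (auto simp: S_def direct_sum_def module_mat_simps)
  ultimately show ?thesis
    unfolding has_JK_invariants_def by blast
qed

theorem theorem3p31:
  fixes m n :: nat
  assumes "0 < m" and "0 < n"
  shows
    "(m \<le> n \<longrightarrow>
       has_JK_invariants (\<bb> n) (Mat n m) standard_sum
         \<lparr> jordan_sizes = replicate_mset m {#1#},
           horizontal_indices = (\<Sum>j = 1..n - m. balanced_indices 1 m j),
           vertical_indices = (\<Sum>j = 1..m - 1. balanced_indices 0 m j) \<rparr> \<and>
       size (\<Sum>j = 1..n - m. balanced_indices 1 m j) = (n - m) * (n - m + 1) div 2 \<and>
       size (\<Sum>j = 1..m - 1. balanced_indices 0 m j) = m * (m - 1) div 2) \<and>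
     (m > n \<longrightarrow>
       has_JK_invariants (\<bb> n) (Mat n m) standard_sum
         \<lparr> jordan_sizes = {#},
           horizontal_indices = {#},
           vertical_indices = (\<Sum>j = 1..n. balanced_indices 0 m (m - j)) \<rparr> \<and>
       size (\<Sum>j = 1..n. balanced_indices 0 m (m - j)) = n * m - n * (n + 1) div 2)"
  \<comment> \<open>For \<open>m > n\<close> the difference \<open>n - m\<close> is 0, so the
    horizontal sum is empty. The vertical count for \<open>m \<le> n\<close> is the triangular
    number of \<open>m - 1\<close>.\<close>
  using has_JK_invariants_standard_sum[OF assms(1), of n]
    size_sum_balanced_indices[of 1 m "n - m"] size_sum_balanced_indices[of 0 m "m - 1"]
    size_sum_balanced_indices_diff[of n m 0] assms(1)
  by (auto simp: mult.commute)

end
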